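(* Let $A\in\mathbb{M}_n^+$ be given with a diagonalization $A=\sum_{i=1}^n a_i|v_i\rangle\langle v_i|$, where $a_1\ge a_2\ge\dots\ge a_n\ (\ge 0)$ and $\{v_1,\dots,v_n\}$ is an orthonormal basis of $\mathbb{C}^n$ (so $Av_i=a_iv_i$ for $1\le i\le n$). Let $K\in\mathbb{M}_n$ with $K\ne0$. Let $1\le l_1<l_2<\dots<l_m\le n$ be the indices $i$ for which $Kv_i\notin\mathrm{span}\{Kv_1,\dots,Kv_{i-1}\}$ (for $i=1$ the span is $\{0\}$), so that $Kv_{l_1},\dots,Kv_{l_m}$ are linearly independent and every other $Kv_i$ lies in the span of those $Kv_{l_k}$ with $l_k<i$. Let $u_1,\dots,u_m$ be the orthonormal vectors obtained from $Kv_{l_1},\dots,Kv_{l_m}$ (in this order) by the Gram-Schmidt orthogonalization (in particular $u_1=Kv_{l_1}/\|Kv_{l_1}\|$). Then $$\lim_{p\to\infty}(KA^pK^* )^{1/p}=\sum_{k=1}^m a_{l_k}|u_k\rangle\langle u_k|,$$ and in particular, $$\lim_{p\to\infty}\lambda_k\bigl((KA^pK^* )^{1/p}\bigr)=\begin{cases}a_{l_k}, & 1\le k\le m,\\ 0, & m<k\le n.\end{cases}$$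
   Context: $\mathbb{M}_n$ is the algebra of $n\times n$ complex matrices and $\mathbb{M}_n^+$ the set of positive semidefinite matrices in $\mathbb{M}_n$. For $X\in\mathbb{M}_n^+$, $\lambda_1(X)\ge\dots\ge\lambda_n(X)$ are the eigenvalues of $X$ in decreasing order with multiplicities. $|u\rangle\langle v|$ denotes the rank-one operator $x\mapsto\langle v,x\rangle u$. For $X\in\mathbb{M}_n^+$ and real $p>0$, $X^p$ is defined by functional calculus (with $0^p=0$). The limit is over real $p\to\infty$. *)

theory Defs
  imports "HOL-Analysis.Analysis" "HOL-Computational_Algebra.Computational_Algebra"
begin

text \<open>
  Matrices over \<open>\<complex>\<close> of size \<open>n\<close> are elements of \<open>complex^'n^'n\<close>, with \<open>n = CARD('n)\<close>; limits
  of matrices are taken in the norm topology of this type. The linear span over \<open>\<complex>\<close> is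
  \<open>vec.span\<close> (the constant \<open>span\<close> is the span over \<open>\<real>\<close>), and the inner product of the class
  \<open>real_inner\<close> on \<open>complex^'n\<close> is the real part of \<open>cinner\<close> below, with the same norm.
\<close>

text \<open>Conjugate-linear in the first argument.\<close>

definition cinner :: "complex^'n \<Rightarrow> complex^'n \<Rightarrow> complex" where
  "cinner x y = (\<Sum>i\<in>UNIV. cnj (x $ i) * y $ i)"

definition ketbra :: "complex^'n \<Rightarrow> complex^'n \<Rightarrow> complex^'n^'n" where
  "ketbra u v = matrix (\<lambda>x. cinner v x *s u)"

definition conj_transpose :: "complex^'n^'n \<Rightarrow> complex^'n^'n" where
  "conj_transpose X = (\<chi> i j. cnj (X $ j $ i))"

definition psd :: "complex^'n^'n \<Rightarrow> bool" where
  "psd X \<longleftrightarrow> conj_transpose X = X \<and> (\<forall>x. 0 \<le> Re (cinner x (X *v x)))"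

text \<open>Orthonormal bases are enumerated by \<open>1, \<dots>, n\<close>; values at other indices are irrelevant.\<close>

definition orthonormal_basis :: "(nat \<Rightarrow> complex^'n) \<Rightarrow> bool" where
  "orthonormal_basis v \<longleftrightarrow>
     (\<forall>i\<in>{1..CARD('n)}. \<forall>j\<in>{1..CARD('n)}. cinner (v i) (v j) = (if i = j then 1 else 0)) \<and>
     vec.span (v ` {1..CARD('n)}) = UNIV"

definition diagonalization :: "complex^'n^'n \<Rightarrow> (nat \<Rightarrow> real) \<Rightarrow> (nat \<Rightarrow> complex^'n) \<Rightarrow> bool" where
  "diagonalization X a v \<longleftrightarrow>
     orthonormal_basis v \<and> X = (\<Sum>i=1..CARD('n). a i *\<^sub>R ketbra (v i) (v i))"

text \<open>
  Functional calculus \<open>f(X) = \<Sum>\<^sub>i f(a\<^sub>i) |v\<^sub>i\<rangle>\<langle>v\<^sub>i|\<close> for Hermitian \<open>X = \<Sum>\<^sub>i a\<^sub>i |v\<^sub>i\<rangle>\<langle>v\<^sub>i|\<close>. Such a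
  diagonalization exists by the spectral theorem, and the result is the same for all of them
  (lemma \<open>diagonalization_unique\<close>). No meaning is attached to the value for non-Hermitian \<open>X\<close>.
\<close>

definition fun_calculus :: "(real \<Rightarrow> real) \<Rightarrow> complex^'n^'n \<Rightarrow> complex^'n^'n" where
  "fun_calculus f X =
     (THE Y. \<exists>a v. diagonalization X a v \<and> diagonalization Y (\<lambda>i. f (a i)) v)"

text \<open>For positive semidefinite \<open>X\<close> and \<open>p > 0\<close>; note \<open>0 powr p = 0\<close>.\<close>

definition mat_powr :: "complex^'n^'n \<Rightarrow> real \<Rightarrow> complex^'n^'n" where
  "mat_powr X p = fun_calculus (\<lambda>t. t powr p) X"

definition charpoly :: "complex^'n^'n \<Rightarrow> complex poly" where
  "charpoly X = det (\<chi> i j. (if i = j then [:0, 1:] else 0) - [:X $ i $ j:])"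

text \<open>
  \<open>eigval X k\<close> is the \<open>k\<close>-th largest eigenvalue (\<open>1 \<le> k \<le> n\<close>), counted with multiplicity, of a
  Hermitian matrix \<open>X\<close>; all roots of \<open>charpoly X\<close> are then real, so \<open>Re\<close> loses nothing.
\<close>

definition eigval :: "complex^'n^'n \<Rightarrow> nat \<Rightarrow> real" where
  "eigval X k = rev (sorted_list_of_multiset (image_mset Re (proots (charpoly X)))) ! (k - 1)"

text \<open>Gram-Schmidt orthonormalization of the sequence \<open>w 1, w 2, \<dots>\<close>.\<close>

function gram_schmidt :: "(nat \<Rightarrow> complex^'n) \<Rightarrow> nat \<Rightarrow> complex^'n" where
  "gram_schmidt w k =
     (let r = w k - (\<Sum>j\<in>{1..<k}. cinner (gram_schmidt w j) (w k) *s gram_schmidt w j)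
      in (1 / norm r) *\<^sub>R r)"
  by pat_completeness auto
termination by (relation "Wellfounded.measure snd") auto

declare gram_schmidt.simps [simp del]

lemma cinner_add: "cinner x (y + z) = cinner x y + cinner x z"
  by (simp add: cinner_def algebra_simps sum.distrib)

lemma cinner_scale: "cinner x (c *s y) = c * cinner x y"
  by (simp add: cinner_def algebra_simps sum_distrib_left)

lemma scaleR_eq_scale: "r *\<^sub>R (y :: complex^'n) = complex_of_real r *s y"
  by (simp add: vec_eq_iff scaleR_conv_of_real[where 'a = complex])

lemma ketbra_mult: "ketbra u v *v x = cinner v x *s u"
proof -
  have "Vector_Spaces.linear (*s) (*s) (\<lambda>x. cinner v x *s u)"
    by unfold_locales (simp_all add: cinner_add cinner_scale vec.scale_left_distrib)
  then show ?thesis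
    unfolding ketbra_def by (rule matrix_works)
qed

lemma sum_ketbra_mult:
  fixes a :: "nat \<Rightarrow> real"
  assumes "finite I"
  shows "(\<Sum>i\<in>I. a i *\<^sub>R ketbra (v i) (v i)) *v x = (\<Sum>i\<in>I. a i *\<^sub>R (cinner (v i) x *s v i))"
  using assms
proof (induction I rule: finite_induct)
  case (insert i I)
  have "(a i *\<^sub>R ketbra (v i) (v i)) *v x = a i *\<^sub>R (ketbra (v i) (v i) *v x)"
    by (simp add: vec_eq_iff matrix_vector_mult_def scaleR_sum_right)
  with insert show ?case
    by (simp add: matrix_vector_mult_add_rdistrib ketbra_mult)
qed simp

lemma diagonalization_mult:
  fixes X :: "complex^'n^'n"
  assumes "diagonalization X a v"
  shows "X *v x = (\<Sum>i=1..CARD('n). a i *\<^sub>R (cinner (v i) x *s v i))"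
  using assms sum_ketbra_mult[of "{1..CARD('n)}" a v x] by (simp add: diagonalization_def)

lemma sum_orthonormal:
  fixes v :: "nat \<Rightarrow> complex^'n"
  assumes "orthonormal_basis v" "k \<in> {1..CARD('n)}"
  shows "(\<Sum>i=1..CARD('n). a i *\<^sub>R (cinner (v i) (v k) *s v i)) = a k *\<^sub>R v k"
proof -
  have "(\<Sum>i=1..CARD('n). a i *\<^sub>R (cinner (v i) (v k) *s v i))
      = (\<Sum>i=1..CARD('n). if i = k then a k *\<^sub>R v k else 0)"
    using assms by (intro sum.cong) (auto simp: orthonormal_basis_def)
  then show ?thesis using assms(2) by simp
qed

lemma orthonormal_basis_matrix_eqI:
  fixes X Y :: "complex^'n^'n"
  assumes "orthonormal_basis v" "\<And>k. k \<in> {1..CARD('n)} \<Longrightarrow> X *v v k = Y *v v k"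
  shows "X = Y"
proof -
  have "X *v x = Y *v x" for x
  proof (rule vec.linear_eq_on[of "(*v) X" "(*v) Y" x "v ` {1..CARD('n)}"])
    show "x \<in> vec.span (v ` {1..CARD('n)})"
      using assms(1) by (simp add: orthonormal_basis_def)
  qed (use assms(2) in auto)
  then show ?thesis by (simp add: matrix_eq)
qed

lemma orthonormal_basis_expand:
  fixes v :: "nat \<Rightarrow> complex^'n"
  assumes "orthonormal_basis v"
  shows "(\<Sum>i=1..CARD('n). cinner (v i) x *s v i) = x"
proof -
  define M where "M = (\<Sum>i=1..CARD('n). (1::real) *\<^sub>R ketbra (v i) (v i))"
  have M: "M *v x = (\<Sum>i=1..CARD('n). (1::real) *\<^sub>R (cinner (v i) x *s v i))" for x
    unfolding M_def by (rule sum_ketbra_mult) simp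
  have "M = mat 1"
    using sum_orthonormal[OF assms, of _ "\<lambda>_. 1"]
    by (intro orthonormal_basis_matrix_eqI[OF assms]) (simp add: M)
  then show ?thesis using M[of x] by simp
qed

lemma cinner_diagonalization:
  fixes X :: "complex^'n^'n"
  assumes "diagonalization X a v" "k \<in> {1..CARD('n)}"
  shows "cinner (v k) (X *v x) = of_real (a k) * cinner (v k) x"
proof -
  have o: "cinner (v k) (v i) = (if k = i then 1 else 0)" if "i \<in> {1..CARD('n)}" for i
    using assms that by (simp add: diagonalization_def orthonormal_basis_def)
  have sum: "cinner y (\<Sum>i\<in>I. g i) = (\<Sum>i\<in>I. cinner y (g i))" if "finite I"
    for y and g :: "nat \<Rightarrow> complex^'n" and I
    using that
    by (induction I rule: finite_induct) (simp_all add: cinner_add, simp add: cinner_def)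
  have "cinner (v k) (X *v x)
      = (\<Sum>i=1..CARD('n). of_real (a i) * (cinner (v i) x * cinner (v k) (v i)))"
    by (simp only: diagonalization_mult[OF assms(1)] sum scaleR_eq_scale cinner_scale finite_atLeastAtMost)
  also have "\<dots> = (\<Sum>i=1..CARD('n). if k = i then of_real (a k) * cinner (v k) x else 0)"
    by (intro sum.cong) (auto simp: o)
  finally show ?thesis using assms(2) by simp
qed

lemma diagonalization_unique:
  fixes X Y Z :: "complex^'n^'n"
  assumes X: "diagonalization X a v" "diagonalization X b w"
    and Y: "diagonalization Y (\<lambda>i. f (a i)) v" and Z: "diagonalization Z (\<lambda>i. f (b i)) w"
  shows "Y = Z"
proof (rule orthonormal_basis_matrix_eqI)
  show w: "orthonormal_basis w" using X(2) by (simp add: diagonalization_def)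
  have v: "orthonormal_basis v" using X(1) by (simp add: diagonalization_def)
  fix k assume k: "k \<in> {1..CARD('n)}"
  have Xw: "X *v w k = b k *\<^sub>R w k"
    using sum_orthonormal[OF w k] by (simp add: diagonalization_mult[OF X(2)])
  have "f (a i) *\<^sub>R (cinner (v i) (w k) *s v i) = f (b k) *\<^sub>R (cinner (v i) (w k) *s v i)"
    if "i \<in> {1..CARD('n)}" for i
  proof (cases "cinner (v i) (w k) = 0")
    case False
    have "of_real (b k) * cinner (v i) (w k) = of_real (a i) * cinner (v i) (w k)"
      using cinner_diagonalization[OF X(1) that, of "w k"] by (simp add: Xw scaleR_eq_scale cinner_scale)
    with False show ?thesis by simp
  qed simp
  then have "Y *v w k = (\<Sum>i=1..CARD('n). f (b k) *\<^sub>R (cinner (v i) (w k) *s v i))"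
    unfolding diagonalization_mult[OF Y] by (rule sum.cong[OF refl])
  also have "\<dots> = f (b k) *\<^sub>R w k"
    by (simp only: scaleR_sum_right[symmetric] orthonormal_basis_expand[OF v])
  also have "\<dots> = Z *v w k"
    using sum_orthonormal[OF w k, of "\<lambda>i. f (b i)"] by (simp add: diagonalization_mult[OF Z])
  finally show "Y *v w k = Z *v w k" .
qed

lemma fun_calculus_eqI:
  assumes "diagonalization X a v" "diagonalization Y (\<lambda>i. f (a i)) v"
  shows "fun_calculus f X = Y"
  unfolding fun_calculus_def using assms diagonalization_unique by (intro the_equality) blast+

end

theory Submission
  imports Defs
begin

text \<open>
  Write \<open>w\<^sub>i = K v\<^sub>i\<close>, so that \<open>M\<^sub>p = K A\<^sup>p K* = \<Sum>\<^sub>i a\<^sub>i\<^sup>p |w\<^sub>i\<rangle>\<langle>w\<^sub>i|\<close> (\<open>congruence_weighted_frame\<close>). Complete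
  the Gram-Schmidt vectors to an orthonormal basis \<open>e\<^sub>1, \<dots>, e\<^sub>n\<close> and let \<open>b\<^sub>k\<close> be the \<open>a\<close>-value at the
  \<open>k\<close>-th pivot index for \<open>k \<le> m\<close>, and \<open>0\<close> for \<open>k > m\<close>. The claimed limit is the matrix \<open>D\<close> with
  eigenvectors \<open>e\<^sub>k\<close> and eigenvalues \<open>b\<^sub>k\<close>.

  Gram-Schmidt is triangular: \<open>e\<^sub>k\<close> is a combination of vectors \<open>w\<^sub>i\<close> with \<open>a\<^sub>i \<ge> b\<^sub>k\<close> (if \<open>k \<le> m\<close>), and
  it is orthogonal to every \<open>w\<^sub>i\<close> with \<open>a\<^sub>i > b\<^sub>k\<close>. In terms of matrices this implies
  \<open>c D\<^sup>p \<le> M\<^sub>p \<le> C D\<^sup>p\<close> with constants independent of \<open>p\<close>, and the Loewner-Heinz theorem would give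
  \<open>c\<^sup>1\<^sup>/\<^sup>p D \<le> M\<^sub>p\<^sup>1\<^sup>/\<^sup>p \<le> C\<^sup>1\<^sup>/\<^sup>p D\<close>. The proof below replaces operator monotonicity by an elementary argument
  about eigenvectors. Let \<open>x\<close> be a unit eigenvector of \<open>M\<^sub>p\<close> with eigenvalue \<open>t\<^sup>p\<close>. The two facts about
  \<open>e\<^sub>k\<close> yield
  \<open>b\<^sub>k\<^sup>p |\<langle>e\<^sub>k, x\<rangle>|\<^sup>2 \<le> C t\<^sup>p\<close> and \<open>t\<^sup>p |\<langle>e\<^sub>k, x\<rangle>|\<^sup>2 \<le> C b\<^sub>k\<^sup>p\<close>
  (\<open>weight_overlap_le\<close>, \<open>overlap_le_weight\<close>), and taking \<open>p\<close>-th roots,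
  \<open>|t - b\<^sub>k| |\<langle>e\<^sub>k, x\<rangle>| \<le> C' / p\<close> (\<open>eigenvalue_gap_times_overlap\<close>). But \<open>(t - b\<^sub>k) \<langle>e\<^sub>k, x\<rangle>\<close> is exactly the
  matrix element \<open>\<langle>e\<^sub>k, (M\<^sub>p\<^sup>1\<^sup>/\<^sup>p - D) x\<rangle>\<close>, so all entries of \<open>M\<^sub>p\<^sup>1\<^sup>/\<^sup>p - D\<close> are \<open>O(1/p)\<close>
  (\<open>norm_entry_diagonalization_diff\<close>).

  The statement about eigenvalues follows from the convergence of the matrices by Weyl's inequality
  (\<open>ordered_eigenvalue_perturbation\<close>). Eigenvectors of \<open>M\<^sub>p\<close> come from the spectral theorem
  (\<open>hermitian_diagonalization\<close>), which is derived by maximizing the Rayleigh quotient.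
\<close>

(* The symbol $ below always denotes a vector component, not a coefficient of a power series. *)
unbundle no Formal_Power_Series.fps_syntax

section \<open>The complex inner product and orthonormal systems\<close>

lemma cinner_commute: "cnj (cinner x y) = cinner y x"
  by (simp add: cinner_def mult.commute)

lemma cinner_eq_0_commute: "cinner x y = 0 \<longleftrightarrow> cinner y x = 0"
  using cinner_commute[of x y] by auto

lemma cinner_add_left: "cinner (x + y) z = cinner x z + cinner y z"
  by (simp add: cinner_def algebra_simps sum.distrib)

lemma cinner_scale_left: "cinner (c *s x) y = cnj c * cinner x y"
  by (simp add: cinner_def algebra_simps sum_distrib_left)

lemma cinner_diff: "cinner x (y - z) = cinner x y - cinner x z"
  by (simp add: cinner_def algebra_simps sum_subtractf)

lemma cinner_diff_left: "cinner (x - y) z = cinner x z - cinner y z"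
  by (simp add: cinner_def algebra_simps sum_subtractf)

lemma cinner_zero [simp]: "cinner x 0 = 0" "cinner 0 x = 0"
  by (simp_all add: cinner_def)

lemma cinner_sum: "cinner x (\<Sum>i\<in>I. g i) = (\<Sum>i\<in>I. cinner x (g i))"
  by (induction I rule: infinite_finite_induct) (simp_all add: cinner_add)

lemma cinner_scaleR: "cinner x (r *\<^sub>R y) = of_real r * cinner x y"
  by (simp add: scaleR_eq_scale cinner_scale)

lemma cinner_scaleR_left: "cinner (r *\<^sub>R x) y = of_real r * cinner x y"
  by (simp add: scaleR_eq_scale cinner_scale_left)

lemma cinner_self: "cinner x x = of_real ((norm x)\<^sup>2)"
proof -
  have "cinner x x = (\<Sum>i\<in>UNIV. of_real ((norm (x $ i))\<^sup>2))"
    unfolding cinner_def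
    by (intro sum.cong refl) (metis complex_norm_square mult.commute of_real_power)
  then show ?thesis
    by (simp add: norm_vec_def L2_set_def sum_nonneg)
qed

lemma cinner_matrix: "cinner x (X *v y) = cinner (conj_transpose X *v x) y"
proof -
  have "cinner x (X *v y) = (\<Sum>i\<in>UNIV. \<Sum>j\<in>UNIV. cnj (x $ i) * (X $ i $ j * y $ j))"
    by (simp add: cinner_def matrix_vector_mult_def sum_distrib_left)
  also have "\<dots> = (\<Sum>j\<in>UNIV. \<Sum>i\<in>UNIV. cnj (x $ i) * (X $ i $ j * y $ j))"
    by (rule sum.swap)
  finally show ?thesis
    by (simp add: cinner_def matrix_vector_mult_def conj_transpose_def sum_distrib_left
        sum_distrib_right mult_ac)
qed

lemma continuous_on_cinner_matrix:
  fixes X :: "complex^'n^'n"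
  shows "continuous_on S (\<lambda>y. cinner y (X *v y))"
  unfolding cinner_def matrix_vector_mult_def by (auto intro!: continuous_intros)

lemma subspace_orthogonal: "vec.subspace {y. \<forall>f\<in>F. cinner f y = 0}"
  by (auto simp: vec.subspace_def cinner_add cinner_scale)

lemma cinner_span_eq_0:
  assumes "z \<in> vec.span S" "\<And>s. s \<in> S \<Longrightarrow> cinner s y = 0"
  shows "cinner z y = 0"
proof -
  have "z \<in> {z. \<forall>f\<in>{y}. cinner f z = 0}"
    by (rule set_mp[OF vec.span_minimal[OF _ subspace_orthogonal] assms(1)])
      (use assms(2) cinner_eq_0_commute in blast)
  then show ?thesis by (simp add: cinner_eq_0_commute)
qed

text \<open>
  Each further condition \<open>cinner f y = 0\<close> lowers the dimension of the solution space by at most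
  one: a single vector \<open>s\<close> violating it, together with the new solution space, spans the old one.
\<close>

lemma dim_orthogonal:
  fixes F :: "(complex^'n) set"
  assumes "finite F"
  shows "CARD('n) \<le> vec.dim {y. \<forall>f\<in>F. cinner f y = 0} + card F"
  using assms
proof (induction F rule: finite_induct)
  case empty
  then show ?case by (simp add: vec_dim_card del: vec.dim_UNIV)
next
  case (insert f F)
  define S where "S = {y. \<forall>f\<in>F. cinner f y = 0}"
  define T where "T = {y. \<forall>f\<in>insert f F. cinner f y = 0}"
  have "vec.dim S \<le> vec.dim T + 1"
  proof (cases "S \<subseteq> T")
    case True
    then show ?thesis using vec.dim_subset[OF True] by simp
  next
    case False
    then obtain s where s: "s \<in> S" "cinner f s \<noteq> 0" by (auto simp: S_def T_def)
    have "S \<subseteq> vec.span (insert s T)"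
    proof
      fix y assume y: "y \<in> S"
      define c where "c = cinner f y / cinner f s"
      have "y - c *s s \<in> T"
        using s y by (auto simp: S_def T_def cinner_diff cinner_scale c_def)
      then have "y - c *s s \<in> vec.span (insert s T)"
        by (simp add: vec.span_base)
      moreover have "c *s s \<in> vec.span (insert s T)"
        by (simp add: vec.span_base vec.span_scale)
      ultimately show "y \<in> vec.span (insert s T)"
        using vec.span_add by fastforce
    qed
    then have "vec.dim S \<le> vec.dim (insert s T)"
      using vec.dim_subset vec.dim_span by metis
    also have "\<dots> \<le> vec.dim T + 1" by (simp add: vec.dim_insert)
    finally show ?thesis .
  qed
  with insert show ?case by (simp add: S_def T_def)
qed

lemma exists_unit_orthogonal:
  fixes F :: "(complex^'n) set"
  assumes "finite F" "card F < CARD('n)"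
  obtains y where "norm y = 1" "\<And>f. f \<in> F \<Longrightarrow> cinner f y = 0"
proof -
  define S where "S = {y. \<forall>f\<in>F. cinner f y = 0}"
  have "vec.dim S > 0" using dim_orthogonal[OF assms(1)] assms(2) by (simp add: S_def)
  then obtain y where y: "y \<in> S" "y \<noteq> 0"
    by (metis vec.dim_eq_0 not_gr_zero singletonD singletonI subset_iff insertCI)
  show ?thesis
  proof (rule that)
    show "norm ((1 / norm y) *\<^sub>R y) = 1" using y by simp
    show "cinner f ((1 / norm y) *\<^sub>R y) = 0" if "f \<in> F" for f
      using y that by (simp add: S_def cinner_scaleR)
  qed
qed

text \<open>
  Partial orthonormal systems, so that bases can be built one vector at a time. Only the indices
  \<open>1, \<dots>, k\<close> matter, which makes the predicate stable under \<open>fun_upd\<close> at \<open>Suc k\<close>.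
\<close>

definition orthonormal_upto :: "nat \<Rightarrow> (nat \<Rightarrow> complex^'n) \<Rightarrow> bool" where
  "orthonormal_upto k v \<longleftrightarrow>
     (\<forall>i\<in>{1..k}. \<forall>j\<in>{1..k}. cinner (v i) (v j) = (if i = j then 1 else 0))"

lemma orthonormal_uptoD:
  assumes "orthonormal_upto k v" "i \<in> {1..k}" "j \<in> {1..k}"
  shows "cinner (v i) (v j) = (if i = j then 1 else 0)"
  using assms by (simp add: orthonormal_upto_def)

lemma orthonormal_upto_norm:
  assumes "orthonormal_upto k v" "i \<in> {1..k}"
  shows "norm (v i) = 1"
proof -
  have "complex_of_real ((norm (v i))\<^sup>2) = 1"
    using assms by (metis cinner_self orthonormal_uptoD)
  then have "(norm (v i))\<^sup>2 = 1" by (simp only: of_real_eq_1_iff)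
  then show ?thesis by (simp add: power2_eq_1_iff) (smt (verit) norm_ge_zero)
qed

lemma orthonormal_upto_Suc:
  assumes "orthonormal_upto k v" "norm (v (Suc k)) = 1"
    and "\<And>i. i \<in> {1..k} \<Longrightarrow> cinner (v i) (v (Suc k)) = 0"
  shows "orthonormal_upto (Suc k) v"
proof -
  have "cinner (v (Suc k)) (v i) = 0" if "i \<in> {1..k}" for i
    using assms(3)[OF that] by (simp add: cinner_eq_0_commute)
  moreover have "cinner (v (Suc k)) (v (Suc k)) = 1"
    by (simp add: cinner_self assms(2))
  moreover have "{1..Suc k} = insert (Suc k) {1..k}" by auto
  ultimately show ?thesis
    using assms(1,3) by (auto simp: orthonormal_upto_def)
qed

lemma orthonormal_upto_cong:
  assumes "orthonormal_upto k v" "\<And>i. i \<in> {1..k} \<Longrightarrow> w i = v i"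
  shows "orthonormal_upto k w"
  using assms by (simp add: orthonormal_upto_def)

lemma orthonormal_basis_iff:
  fixes v :: "nat \<Rightarrow> complex^'n"
  shows "orthonormal_basis v \<longleftrightarrow> orthonormal_upto CARD('n) v"
proof
  assume v: "orthonormal_upto CARD('n) v"
  let ?B = "v ` {1..CARD('n)}"
  have inj: "inj_on v {1..CARD('n)}"
    using orthonormal_uptoD[OF v] by (intro inj_onI) (metis zero_neq_one)
  have "vec.independent ?B"
    unfolding vec.dependent_def
  proof safe
    fix i assume i: "i \<in> {1..CARD('n)}" and s: "v i \<in> vec.span (?B - {v i})"
    have "cinner (v i) (v i) = 0"
      by (rule cinner_span_eq_0[OF s]) (use orthonormal_uptoD[OF v] i in auto)
    then show False using orthonormal_uptoD[OF v i i] by simp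
  qed
  then have "UNIV \<subseteq> vec.span ?B"
    using inj by (intro vec.card_ge_dim_independent) (simp_all add: card_image vec_dim_card del: vec.dim_UNIV)
  then show "orthonormal_basis v"
    using v by (auto simp: orthonormal_basis_def orthonormal_upto_def)
qed (simp add: orthonormal_basis_def orthonormal_upto_def)

lemma orthonormal_upto_extend:
  fixes v :: "nat \<Rightarrow> complex^'n"
  assumes "orthonormal_upto k v" "k \<le> CARD('n)"
  obtains w where "orthonormal_basis w" "\<And>i. i \<in> {1..k} \<Longrightarrow> w i = v i"
proof -
  have "\<exists>w. orthonormal_upto CARD('n) w \<and> (\<forall>i\<in>{1..k}. w i = v i)"
    using assms(2,1)
  proof (induction k arbitrary: v rule: inc_induct)
    case (step k)
    have "card (v ` {1..k}) < CARD('n)"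
      using step.hyps card_image_le[of "{1..k}" v] by simp
    then obtain y where y: "norm y = 1" "\<And>f. f \<in> v ` {1..k} \<Longrightarrow> cinner f y = 0"
      using exists_unit_orthogonal[of "v ` {1..k}"] by blast
    have "orthonormal_upto (Suc k) (v(Suc k := y))"
      using y by (intro orthonormal_upto_Suc orthonormal_upto_cong[OF step.prems]) auto
    from step.IH[OF this] obtain w where w: "orthonormal_upto CARD('n) w"
      "\<forall>i\<in>{1..Suc k}. w i = (v(Suc k := y)) i"
      by blast
    then have "\<forall>i\<in>{1..k}. w i = v i" by auto
    with w show ?case by blast
  qed auto
  then show ?thesis using that orthonormal_basis_iff by blast
qed

lemma parseval:
  fixes v :: "nat \<Rightarrow> complex^'n"
  assumes "orthonormal_basis v"
  shows "(\<Sum>i=1..CARD('n). (norm (cinner (v i) x))\<^sup>2) = (norm x)\<^sup>2"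
proof -
  have "cinner x x = cinner x (\<Sum>i=1..CARD('n). cinner (v i) x *s v i)"
    by (simp only: orthonormal_basis_expand[OF assms])
  also have "\<dots> = (\<Sum>i=1..CARD('n). cinner (v i) x * cnj (cinner (v i) x))"
    by (simp only: cinner_sum cinner_scale cinner_commute)
  also have "\<dots> = of_real (\<Sum>i=1..CARD('n). (norm (cinner (v i) x))\<^sup>2)"
    by (simp only: of_real_sum complex_norm_square)
  finally show ?thesis by (simp only: cinner_self of_real_eq_iff)
qed

lemma quadratic_form_diagonalization:
  fixes X :: "complex^'n^'n"
  assumes "diagonalization X a v"
  shows "Re (cinner y (X *v y)) = (\<Sum>i=1..CARD('n). a i * (norm (cinner (v i) y))\<^sup>2)"
proof -
  have "cinner y (X *v y) = (\<Sum>i=1..CARD('n). of_real (a i) * (cinner (v i) y * cnj (cinner (v i) y)))"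
    by (simp only: diagonalization_mult[OF assms] cinner_sum cinner_scale cinner_scaleR cinner_commute)
  also have "\<dots> = of_real (\<Sum>i=1..CARD('n). a i * (norm (cinner (v i) y))\<^sup>2)"
    by (simp only: of_real_sum complex_norm_square of_real_mult)
  finally show ?thesis by simp
qed

lemma diagonalization_eigenvector:
  fixes X :: "complex^'n^'n"
  assumes "diagonalization X a v" "k \<in> {1..CARD('n)}"
  shows "X *v v k = a k *\<^sub>R v k"
  unfolding diagonalization_mult[OF assms(1)]
  using assms by (intro sum_orthonormal) (simp_all add: diagonalization_def)

lemma diagonalizationI:
  fixes X :: "complex^'n^'n"
  assumes v: "orthonormal_basis v"
    and eig: "\<And>k. k \<in> {1..CARD('n)} \<Longrightarrow> X *v v k = a k *\<^sub>R v k"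
  shows "diagonalization X a v"
proof -
  let ?Y = "\<Sum>i=1..CARD('n). a i *\<^sub>R ketbra (v i) (v i)"
  have Y: "diagonalization ?Y a v" using v by (simp add: diagonalization_def)
  have "X = ?Y"
    by (rule orthonormal_basis_matrix_eqI[OF v])
      (simp only: eig diagonalization_eigenvector[OF Y])
  with Y show ?thesis by metis
qed

section \<open>The spectral theorem\<close>

text \<open>
  Let \<open>\<mu>\<close> be the maximum of the Rayleigh quotient on \<open>S\<close>. The form
  \<open>Q y = \<mu> \<parallel>y\<parallel>\<^sup>2 - \<langle>y, X y\<rangle>\<close> is nonnegative on \<open>S\<close> and vanishes at the maximizer \<open>x\<close>. Moving from
  \<open>x\<close> in the direction \<open>- z\<close> with \<open>z = \<mu> x - X x\<close>, which lies in \<open>S\<close> by invariance, changes \<open>Q\<close>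
  to first order by \<open>- 2 t \<parallel>z\<parallel>\<^sup>2\<close>; so \<open>z = 0\<close>.
\<close>

lemma rayleigh_maximizer_eigenvector:
  fixes X :: "complex^'n^'n"
  assumes herm: "conj_transpose X = X"
    and S: "vec.subspace S" "\<And>z. z \<in> S \<Longrightarrow> X *v z \<in> S"
    and x: "x \<in> S" "norm x = 1"
    and max: "\<And>y. y \<in> S \<Longrightarrow> norm y = 1 \<Longrightarrow> Re (cinner y (X *v y)) \<le> Re (cinner x (X *v x))"
  shows "X *v x = Re (cinner x (X *v x)) *\<^sub>R x"
proof -
  define \<mu> where "\<mu> = Re (cinner x (X *v x))"
  define Q where "Q y = \<mu> * (norm y)\<^sup>2 - Re (cinner y (X *v y))" for y
  define z where "z = \<mu> *\<^sub>R x - X *v x"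
  have zS: "z \<in> S"
    unfolding z_def scaleR_eq_scale using S x
    by (intro vec.subspace_diff vec.subspace_scale) auto
  have Qpos: "0 \<le> Q y" if "y \<in> S" for y
  proof (cases "y = 0")
    case False
    let ?y = "(1 / norm y) *\<^sub>R y"
    have "?y \<in> S" using that S by (simp add: scaleR_eq_scale vec.subspace_scale del: of_real_divide)
    then have "Re (cinner ?y (X *v ?y)) \<le> \<mu>"
      unfolding \<mu>_def using False by (intro max) auto
    moreover have "X *v ?y = (1 / norm y) *\<^sub>R (X *v y)"
      by (simp add: scaleR_eq_scale vec.linear_scale)
    then have "cinner ?y (X *v ?y) = of_real (1 / norm y) * (of_real (1 / norm y) * cinner y (X *v y))"
      by (simp only: cinner_scaleR cinner_scaleR_left)
    ultimately show ?thesis using False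
      by (simp add: Q_def field_simps power2_eq_square)
  qed (simp add: Q_def)
  have Xsym: "cinner y (X *v w) = cinner (X *v y) w" for y w
    by (simp add: cinner_matrix herm)
  have expand: "Q (x - t *\<^sub>R z) = - 2 * t * (norm z)\<^sup>2 + t\<^sup>2 * Q z" for t :: real
  proof -
    have 0: "X *v (x - t *\<^sub>R z) = X *v x - t *\<^sub>R (X *v z)"
      by (simp add: scaleR_eq_scale vec.linear_scale matrix_vector_mult_diff_distrib)
    have 1: "cinner (x - t *\<^sub>R z) (X *v (x - t *\<^sub>R z))
        = cinner x (X *v x) - t * cinner x (X *v z) - t * cinner z (X *v x) + t\<^sup>2 * cinner z (X *v z)"
      unfolding 0 cinner_diff cinner_diff_left cinner_scaleR cinner_scaleR_left
      by (simp add: algebra_simps power2_eq_square)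
    have 2: "complex_of_real ((norm (x - t *\<^sub>R z))\<^sup>2) = cinner x x - t * cinner x z - t * cinner z x + t\<^sup>2 * cinner z z"
      unfolding cinner_self[symmetric] cinner_diff cinner_diff_left cinner_scaleR cinner_scaleR_left
      by (simp add: algebra_simps power2_eq_square)
    have 2: "(norm (x - t *\<^sub>R z))\<^sup>2 = 1 - 2 * t * Re (cinner z x) + t\<^sup>2 * (norm z)\<^sup>2"
      using arg_cong[OF 2, of Re] x cinner_commute[of z x, symmetric] by (simp add: cinner_self)
    have 3: "Re (cinner x (X *v z)) = Re (cinner z (X *v x))"
      unfolding Xsym[of x] cinner_commute[of z "X *v x", symmetric] by simp
    have 4: "(norm z)\<^sup>2 = \<mu> * Re (cinner z x) - Re (cinner z (X *v x))"
    proof -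
      have "complex_of_real ((norm z)\<^sup>2) = \<mu> * cinner z x - cinner z (X *v x)"
        unfolding cinner_self[symmetric] by (subst (2) z_def) (simp only: cinner_diff cinner_scaleR)
      from arg_cong[OF this, of Re] show ?thesis by simp
    qed
    show ?thesis
      unfolding Q_def 1 2 4 using 3 x by (simp add: \<mu>_def[symmetric] algebra_simps)
  qed
  \<comment> \<open>the value 0 at \<open>t = 0\<close> is a minimum of this quadratic polynomial in \<open>t\<close>\<close>
  have ineq: "0 \<le> - 2 * t * (norm z)\<^sup>2 + t\<^sup>2 * Q z" for t :: real
    unfolding expand[symmetric] using zS x S
    by (intro Qpos) (auto simp: scaleR_eq_scale intro!: vec.subspace_diff vec.subspace_scale)
  have "z = 0"
  proof (rule ccontr)
    assume "z \<noteq> 0"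
    then have N: "(norm z)\<^sup>2 > 0" by simp
    \<comment> \<open>so small that the linear term dominates; the \<open>+ 1\<close> avoids a division by 0\<close>
    define t where "t = (norm z)\<^sup>2 / (Q z + 1)"
    have q: "Q z \<ge> 0" by (rule Qpos[OF zS])
    then have t: "t > 0" using N by (simp add: t_def)
    have "t * Q z \<le> (norm z)\<^sup>2" using q N by (simp add: t_def field_simps)
    then have "t * (t * Q z) \<le> t * (norm z)\<^sup>2" using t by simp
    with ineq[of t] mult_pos_pos[OF t N] show False by (simp add: power2_eq_square)
  qed
  then show ?thesis by (simp add: z_def \<mu>_def)
qed

text \<open>
  The spectral theorem, with eigenvalues in decreasing order. Eigenvectors are chosen greedily: the
  next one maximizes the Rayleigh quotient on the orthogonal complement of the previous ones. That
  complement is invariant because \<open>X\<close> is Hermitian. Keeping the maximality of each \<open>x i\<close> on the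
  complement of \<open>x 1, \<dots>, x (i - 1)\<close> in the induction hypothesis yields the order of the eigenvalues
  for free, since every later \<open>x j\<close> competes in that maximum.
\<close>

lemma hermitian_diagonalization:
  fixes X :: "complex^'n^'n"
  assumes herm: "conj_transpose X = X"
  obtains s x where "diagonalization X s x"
    "\<And>i j. 1 \<le> i \<Longrightarrow> i \<le> j \<Longrightarrow> j \<le> CARD('n) \<Longrightarrow> s j \<le> s i"
proof -
  let ?R = "\<lambda>y. Re (cinner y (X *v y))"
  have Xsym: "cinner y (X *v w) = cinner (X *v y) w" for y w
    by (simp add: cinner_matrix herm)
  have "\<exists>x. orthonormal_upto k x \<and> (\<forall>i\<in>{1..k}. X *v x i = ?R (x i) *\<^sub>R x i \<and>
          (\<forall>y. norm y = 1 \<and> (\<forall>f\<in>x ` {1..<i}. cinner f y = 0) \<longrightarrow> ?R y \<le> ?R (x i)))"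
    if "k \<le> CARD('n)" for k
    using that
  proof (induction k)
    case 0
    then show ?case by (auto simp: orthonormal_upto_def)
  next
    case (Suc k)
    then obtain x where x: "orthonormal_upto k x"
      "\<And>i. i \<in> {1..k} \<Longrightarrow> X *v x i = ?R (x i) *\<^sub>R x i"
      "\<And>i y. i \<in> {1..k} \<Longrightarrow> norm y = 1 \<Longrightarrow> (\<forall>f\<in>x ` {1..<i}. cinner f y = 0) \<Longrightarrow> ?R y \<le> ?R (x i)"
      by auto
    define S where "S = {y. \<forall>f\<in>x ` {1..k}. cinner f y = 0}"
    have sub: "vec.subspace S" unfolding S_def by (rule subspace_orthogonal)
    have inv: "X *v z \<in> S" if "z \<in> S" for z
    proof -
      have "cinner (x i) (X *v z) = 0" if "i \<in> {1..k}" for i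
      proof -
        have "cinner (x i) (X *v z) = of_real (?R (x i)) * cinner (x i) z"
          by (metis Xsym cinner_scaleR_left x(2)[OF that])
        moreover have "cinner (x i) z = 0" using that \<open>z \<in> S\<close> by (simp add: S_def)
        ultimately show ?thesis by simp
      qed
      then show ?thesis by (auto simp: S_def)
    qed
    have card: "card (x ` {1..k}) < CARD('n)"
      using Suc.prems card_image_le[of "{1..k}" x] by simp
    obtain y0 where "norm y0 = 1" "\<And>f. f \<in> x ` {1..k} \<Longrightarrow> cinner f y0 = 0"
      using exists_unit_orthogonal[OF _ card] by auto
    then have y0: "norm y0 = 1" "y0 \<in> S" by (auto simp: S_def)
    have "closed (\<Inter>f\<in>x ` {1..k}. {y. cinner f y = 0})"
      unfolding cinner_def by (intro closed_INT ballI closed_Collect_eq continuous_intros)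
    moreover have "S = (\<Inter>f\<in>x ` {1..k}. {y. cinner f y = 0})" by (auto simp: S_def)
    ultimately have "compact (S \<inter> sphere 0 1)" by (simp add: closed_Int_compact)
    moreover have "continuous_on (S \<inter> sphere 0 1) ?R"
      by (intro continuous_on_Re continuous_on_cinner_matrix)
    moreover have "S \<inter> sphere 0 1 \<noteq> {}" using y0 by auto
    ultimately have "\<exists>y\<in>S \<inter> sphere 0 1. \<forall>y'\<in>S \<inter> sphere 0 1. ?R y' \<le> ?R y"
      by (intro continuous_attains_sup)
    then obtain y where "y \<in> S \<inter> sphere 0 1" "\<forall>y'\<in>S \<inter> sphere 0 1. ?R y' \<le> ?R y"
      by (rule bexE)
    then have y: "y \<in> S" "norm y = 1"
      and max: "\<And>y'. y' \<in> S \<Longrightarrow> norm y' = 1 \<Longrightarrow> ?R y' \<le> ?R y"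
      by auto
    have eig: "X *v y = ?R y *\<^sub>R y"
      by (rule rayleigh_maximizer_eigenvector[OF herm sub inv y max])
    define x' where "x' = x(Suc k := y)"
    have x'x: "x' i = x i" if "i \<le> k" for i using that by (simp add: x'_def)
    have x'im: "x' ` {1..<i} = x ` {1..<i}" if "i \<le> Suc k" for i
      using that by (intro image_cong) (auto simp: x'x)
    have "orthonormal_upto (Suc k) x'"
      using y by (intro orthonormal_upto_Suc orthonormal_upto_cong[OF x(1)]) (auto simp: x'_def S_def)
    moreover have "X *v x' i = ?R (x' i) *\<^sub>R x' i \<and>
          (\<forall>y. norm y = 1 \<and> (\<forall>f\<in>x' ` {1..<i}. cinner f y = 0) \<longrightarrow> ?R y \<le> ?R (x' i))"
      if "i \<in> {1..Suc k}" for i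
    proof (cases "i = Suc k")
      case True
      have S: "{1..<Suc k} = {1..k}" and y: "x' (Suc k) = y" by (auto simp: x'_def)
      show ?thesis unfolding x'im[of i, OF eq_refl[OF True]]
        unfolding True S y using eig max by (auto simp only: S_def mem_Collect_eq)
    next
      case False
      with that have i: "i \<in> {1..k}" "i \<le> Suc k" "i \<le> k" by auto
      show ?thesis unfolding x'im[OF i(2)] x'x[OF i(3)] using x(2,3)[OF i(1)] by blast
    qed
    ultimately show ?case by blast
  qed
  from this[OF order_refl] obtain x where x: "orthonormal_upto CARD('n) x"
    "\<And>i. i \<in> {1..CARD('n)} \<Longrightarrow> X *v x i = ?R (x i) *\<^sub>R x i"
    "\<And>i y. i \<in> {1..CARD('n)} \<Longrightarrow> norm y = 1 \<Longrightarrow> (\<forall>f\<in>x ` {1..<i}. cinner f y = 0) \<Longrightarrow> ?R y \<le> ?R (x i)"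
    by blast
  show ?thesis
  proof (rule that)
    show "diagonalization X (\<lambda>i. ?R (x i)) x"
      by (rule diagonalizationI[OF x(1)[folded orthonormal_basis_iff] x(2)])
    show "?R (x j) \<le> ?R (x i)" if "1 \<le> i" "i \<le> j" "j \<le> CARD('n)" for i j
      using that by (intro x(3)) (auto simp: orthonormal_upto_norm[OF x(1)] orthonormal_uptoD[OF x(1)])
  qed
qed

section \<open>Gram-Schmidt vectors and pivot indices\<close>

lemma gram_schmidt_orthonormal_span:
  assumes indep: "\<And>k. k \<in> {1..m} \<Longrightarrow> w k \<notin> vec.span (w ` {1..<k})"
    and "k \<le> m"
  shows "orthonormal_upto k (gram_schmidt w) \<and>
    vec.span (gram_schmidt w ` {1..k}) = vec.span (w ` {1..k})"
  using \<open>k \<le> m\<close>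
proof (induction k)
  case 0
  then show ?case by (simp add: orthonormal_upto_def)
next
  case (Suc k)
  define g where "g = gram_schmidt w"
  have o: "orthonormal_upto k g" and s: "vec.span (g ` {1..k}) = vec.span (w ` {1..k})"
    using Suc by (simp_all add: g_def)
  have iv: "{1..<Suc k} = {1..k}" by auto
  define q where "q = (\<Sum>j=1..k. cinner (g j) (w (Suc k)) *s g j)"
  define r where "r = w (Suc k) - q"
  have gr: "g (Suc k) = (1 / norm r) *\<^sub>R r"
    unfolding g_def r_def q_def gram_schmidt.simps[of w "Suc k"] iv Let_def by simp
  have q: "q \<in> vec.span (g ` {1..k})"
    unfolding q_def by (intro vec.span_sum vec.span_scale vec.span_base) auto
  have "r \<noteq> 0"
  proof
    assume "r = 0"
    then have "w (Suc k) \<in> vec.span (w ` {1..k})" using q s by (simp add: r_def)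
    with indep[of "Suc k"] Suc.prems show False by (simp add: iv del: One_nat_def)
  qed
  then have norm: "norm (g (Suc k)) = 1" by (simp add: gr)
  have orth: "cinner (g i) (g (Suc k)) = 0" if i: "i \<in> {1..k}" for i
  proof -
    have "cinner (g i) q = (\<Sum>j=1..k. if i = j then cinner (g i) (w (Suc k)) else 0)"
      unfolding q_def cinner_sum cinner_scale
      by (intro sum.cong refl) (auto simp: orthonormal_uptoD[OF o i])
    then have "cinner (g i) r = 0" using i by (simp add: r_def cinner_diff)
    then show ?thesis by (simp add: gr cinner_scaleR)
  qed
  have ins: "f ` {1..Suc k} = insert (f (Suc k)) (f ` {1..k})" for f :: "nat \<Rightarrow> complex^'a"
    by (simp add: atLeastAtMostSuc_conv)
  have "vec.span (g ` {1..Suc k}) = vec.span (w ` {1..Suc k})"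
    unfolding vec.span_eq
  proof (intro conjI subsetI)
    let ?W = "vec.span (w ` {1..Suc k})" and ?G = "vec.span (g ` {1..Suc k})"
    have W: "vec.span (g ` {1..k}) \<subseteq> ?W" unfolding s ins by (intro vec.span_mono) auto
    have G: "vec.span (g ` {1..k}) \<subseteq> ?G" unfolding ins by (intro vec.span_mono) auto
    have "w (Suc k) \<in> ?W" by (auto intro: vec.span_base)
    then have "r \<in> ?W" unfolding r_def using q W by (intro vec.span_diff) auto
    then have gW: "g (Suc k) \<in> ?W" unfolding gr scaleR_eq_scale by (rule vec.span_scale)
    show "z \<in> ?W" if "z \<in> g ` {1..Suc k}" for z
      using that gW W vec.span_base[of z "g ` {1..k}"] unfolding ins by blast
    have gG: "g (Suc k) \<in> ?G" by (auto intro: vec.span_base)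
    have "r = norm r *\<^sub>R g (Suc k)" using \<open>r \<noteq> 0\<close> by (simp add: gr)
    then have "r = complex_of_real (norm r) *s g (Suc k)" by (simp only: scaleR_eq_scale)
    then have "r \<in> ?G" using vec.span_scale[OF gG] by metis
    then have "r + q \<in> ?G" using q G by (intro vec.span_add) auto
    then have wG: "w (Suc k) \<in> ?G" by (simp add: r_def)
    show "z \<in> ?G" if "z \<in> w ` {1..Suc k}" for z
      using that wG G vec.span_base[of z "w ` {1..k}"] unfolding ins s[symmetric] by blast
  qed
  then show ?case using orthonormal_upto_Suc[OF o norm orth] by (simp add: g_def)
qed

text \<open>
  A vector that is not a pivot depends on its predecessors, hence by induction on the pivots among
  them.
\<close>

lemma span_pivots:
  assumes "\<And>i. i \<in> {1..n::nat} \<Longrightarrow> w i \<notin> vec.span (w ` {1..<i}) \<Longrightarrow> i \<in> P"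
    and "i \<in> {1..n}"
  shows "w i \<in> vec.span (w ` {j \<in> P. j \<le> i})"
  using assms(2)
proof (induction i rule: less_induct)
  case (less i)
  show ?case
  proof (cases "i \<in> P")
    case True
    then show ?thesis by (intro vec.span_base) auto
  next
    case False
    then have "w i \<in> vec.span (w ` {1..<i})" using assms(1) less.prems by blast
    moreover have "vec.span (w ` {1..<i}) \<subseteq> vec.span (w ` {j \<in> P. j \<le> i})"
    proof (intro vec.span_minimal vec.subspace_span subsetI)
      fix z assume "z \<in> w ` {1..<i}"
      then obtain h where h: "h \<in> {1..<i}" "z = w h" by auto
      then have "w h \<in> vec.span (w ` {j \<in> P. j \<le> h})" using less by auto
      also have "\<dots> \<subseteq> vec.span (w ` {j \<in> P. j \<le> i})" using h by (intro vec.span_mono) auto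
      finally show "z \<in> vec.span (w ` {j \<in> P. j \<le> i})" by (simp only: h)
    qed
    ultimately show ?thesis by blast
  qed
qed

section \<open>Ordered eigenvalues\<close>

lemma poly_charpoly: "poly (charpoly X) z = det (mat z - X)"
proof -
  have "poly (charpoly X) z =
     (\<Sum>p\<in>{p. p permutes UNIV}. of_int (sign p) *
        (\<Prod>i\<in>UNIV. poly ((if i = p i then [:0, 1:] else 0) - [:X $ i $ p i:]) z))"
    by (simp add: charpoly_def det_def poly_sum poly_prod)
  also have "\<dots> = det (mat z - X)"
    unfolding det_def mat_def by (intro sum.cong prod.cong arg_cong2[of _ _ _ _ "(*)"] refl) auto
  finally show ?thesis .
qed

text \<open>
  With the eigenvectors as columns of \<open>V\<close>, \<open>(z - X) V = V D\<close> for a diagonal matrix \<open>D\<close>, and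
  \<open>det V\<close> cancels. The rows and columns are indexed by \<open>'n\<close> but the eigenvectors by
  \<open>1, \<dots>, n\<close>, so a bijection \<open>\<pi>\<close> between the two index sets is fixed.
\<close>

lemma charpoly_diagonalization:
  fixes X :: "complex^'n^'n"
  assumes X: "diagonalization X a v"
  shows "charpoly X = (\<Prod>i=1..CARD('n). [:- of_real (a i), 1:])"
proof -
  obtain \<pi> :: "'n \<Rightarrow> nat" where \<pi>: "bij_betw \<pi> UNIV {1..CARD('n)}"
    using finite_same_card_bij[of "UNIV :: 'n set" "{1..CARD('n)}"] by auto
  have \<pi>_in: "\<pi> i \<in> {1..CARD('n)}" for i using \<pi> by (auto simp: bij_betw_def)
  have o: "orthonormal_upto CARD('n) v"
    using X by (simp add: diagonalization_def orthonormal_basis_iff)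
  define V :: "complex^'n^'n" where "V = (\<chi> i j. v (\<pi> j) $ i)"
  have "conj_transpose V ** V = mat 1"
  proof -
    have "(conj_transpose V ** V) $ i $ j = cinner (v (\<pi> i)) (v (\<pi> j))" for i j
      by (simp add: matrix_matrix_mult_def conj_transpose_def V_def cinner_def)
    also have "\<dots> i j = (if i = j then 1 else 0)" for i j
      using orthonormal_uptoD[OF o \<pi>_in \<pi>_in] \<pi> by (auto simp: bij_betw_def inj_on_def)
    finally show ?thesis by (simp add: vec_eq_iff mat_def)
  qed
  then have "det (conj_transpose V) * det V = 1" by (metis det_mul det_I)
  then have V: "det V \<noteq> 0" by auto
  have "poly (charpoly X) z = poly (\<Prod>i=1..CARD('n). [:- of_real (a i), 1:]) z" for z
  proof -
    define D :: "complex^'n^'n" where "D = (\<chi> i j. if i = j then z - of_real (a (\<pi> i)) else 0)"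
    have "((mat z - X) ** V) $ i $ j = (V ** D) $ i $ j" for i j
    proof -
      have "((mat z - X) ** V) $ i $ j = ((mat z - X) *v v (\<pi> j)) $ i"
        by (simp add: matrix_matrix_mult_def matrix_vector_mult_def V_def)
      also have "(mat z - X) *v v (\<pi> j) = mat z *v v (\<pi> j) - X *v v (\<pi> j)"
        by (rule matrix_vector_mult_diff_rdistrib)
      also have "mat z *v v (\<pi> j) = z *s v (\<pi> j)"
        by (simp add: vec_eq_iff matrix_vector_mult_def mat_def if_distrib[of "\<lambda>c. c * _"] cong: if_cong)
      also have "X *v v (\<pi> j) = of_real (a (\<pi> j)) *s v (\<pi> j)"
        by (simp add: diagonalization_eigenvector[OF X \<pi>_in] scaleR_eq_scale)
      also have "(z *s v (\<pi> j) - of_real (a (\<pi> j)) *s v (\<pi> j)) $ i = V $ i $ j * D $ j $ j"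
        by (simp add: V_def D_def algebra_simps)
      also have "\<dots> = (V ** D) $ i $ j"
        by (simp add: matrix_matrix_mult_def D_def if_distrib[of "\<lambda>c. _ * c"] cong: if_cong)
      finally show ?thesis .
    qed
    then have "(mat z - X) ** V = V ** D" by (simp add: vec_eq_iff)
    then have "det (mat z - X) * det V = det V * det D" by (metis det_mul)
    then have "det (mat z - X) = det D" using V by simp
    also have "\<dots> = (\<Prod>i\<in>UNIV. z - of_real (a (\<pi> i)))"
      by (subst det_diagonal) (auto simp: D_def)
    also have "\<dots> = (\<Prod>i=1..CARD('n). z - of_real (a i))"
      by (rule prod.reindex_bij_betw[OF \<pi>, of "\<lambda>i. z - of_real (a i)"])
    finally show ?thesis by (simp add: poly_charpoly poly_prod)
  qed
  then show ?thesis by (simp add: poly_eq_poly_eq_iff[symmetric] fun_eq_iff)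
qed

lemma eigval_diagonalization:
  fixes X :: "complex^'n^'n"
  assumes X: "diagonalization X a v"
    and dec: "\<And>i j. 1 \<le> i \<Longrightarrow> i \<le> j \<Longrightarrow> j \<le> CARD('n) \<Longrightarrow> a j \<le> a i"
    and k: "k \<in> {1..CARD('n)}"
  shows "eigval X k = a k"
proof -
  define xs where "xs = map a [1..<Suc CARD('n)]"
  have "proots (charpoly X) = (\<Sum>i=1..CARD('n). {#of_real (a i)#})"
    by (simp add: charpoly_diagonalization[OF X] proots_prod)
  moreover have "image_mset Re (\<Sum>i=1..n. {#of_real (a i)#}) = mset (map a [1..<Suc n])" for n
    by (induction n) auto
  ultimately have "image_mset Re (proots (charpoly X)) = mset xs" by (simp only: xs_def)
  moreover have "sort xs = rev xs"
  proof (rule properties_for_sort)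
    show "sorted (rev xs)"
      unfolding sorted_wrt_rev xs_def
      by (auto simp: sorted_wrt_iff_nth_less nth_append simp del: upt_Suc intro!: dec)
  qed simp
  ultimately have "eigval X k = xs ! (k - 1)" by (simp add: eigval_def)
  also have "\<dots> = a k" using k by (cases k) (simp_all add: xs_def del: upt_Suc)
  finally show ?thesis .
qed

lemma norm_quadratic_form_le:
  fixes Z :: "complex^'n^'n"
  assumes "norm y = 1"
  shows "norm (cinner y (Z *v y)) \<le> (\<Sum>i\<in>UNIV. \<Sum>j\<in>UNIV. norm (Z $ i $ j))"
proof -
  have y: "norm (y $ i) \<le> 1" for i using Finite_Cartesian_Product.norm_nth_le[of y i] assms by simp
  have "cinner y (Z *v y) = (\<Sum>i\<in>UNIV. \<Sum>j\<in>UNIV. cnj (y $ i) * (Z $ i $ j * y $ j))"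
    by (simp add: cinner_def matrix_vector_mult_def sum_distrib_left)
  also have "norm \<dots> \<le> (\<Sum>i\<in>UNIV. \<Sum>j\<in>UNIV. norm (Z $ i $ j))"
  proof (intro sum_norm_le)
    fix i j
    have "norm (y $ i) * norm (y $ j) * norm (Z $ i $ j) \<le> 1 * norm (Z $ i $ j)"
      by (intro mult_right_mono mult_le_one y) auto
    then show "norm (cnj (y $ i) * (Z $ i $ j * y $ j)) \<le> norm (Z $ i $ j)"
      by (simp add: norm_mult mult_ac)
  qed
  finally show ?thesis .
qed

text \<open>
  One half of Weyl's inequality. There are \<open>n - k\<close> vectors \<open>v i\<close> with \<open>i > k\<close> and \<open>k - 1\<close>
  vectors \<open>w i\<close> with \<open>i < k\<close>, so some unit vector \<open>y\<close> is orthogonal to all of them. For this \<open>y\<close>,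
  \<open>a k \<le> \<langle>y, X y\<rangle>\<close> and \<open>\<langle>y, Y y\<rangle> \<le> b k\<close>. The bound is stated with the sum of the absolute values of
  the entries, which tends to 0 as soon as every entry does.
\<close>

lemma ordered_eigenvalue_perturbation_le:
  fixes X Y :: "complex^'n^'n"
  assumes X: "diagonalization X a v" and Y: "diagonalization Y b w"
    and a: "\<And>i j. 1 \<le> i \<Longrightarrow> i \<le> j \<Longrightarrow> j \<le> CARD('n) \<Longrightarrow> a j \<le> a i"
    and b: "\<And>i j. 1 \<le> i \<Longrightarrow> i \<le> j \<Longrightarrow> j \<le> CARD('n) \<Longrightarrow> b j \<le> b i"
    and k: "k \<in> {1..CARD('n)}"
  shows "a k - b k \<le> (\<Sum>i\<in>UNIV. \<Sum>j\<in>UNIV. norm ((X - Y) $ i $ j))"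
proof -
  have v: "orthonormal_basis v" and w: "orthonormal_basis w"
    using X Y by (simp_all add: diagonalization_def)
  let ?F = "v ` {k<..CARD('n)} \<union> w ` {1..<k}"
  have "card ?F \<le> card (v ` {k<..CARD('n)}) + card (w ` {1..<k})" by (rule card_Un_le)
  also have "\<dots> \<le> (CARD('n) - k) + (k - 1)"
    by (intro add_mono order_trans[OF card_image_le]) auto
  also have "\<dots> < CARD('n)" using k by auto
  finally have card: "card ?F < CARD('n)" .
  obtain y where y: "norm y = 1" "\<And>f. f \<in> ?F \<Longrightarrow> cinner f y = 0"
    using exists_unit_orthogonal[OF _ card] by auto
  have "a k * (\<Sum>i=1..CARD('n). (norm (cinner (v i) y))\<^sup>2) \<le> Re (cinner y (X *v y))"
    unfolding quadratic_form_diagonalization[OF X] sum_distrib_left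
  proof (intro sum_mono)
    fix i assume i: "i \<in> {1..CARD('n)}"
    show "a k * (norm (cinner (v i) y))\<^sup>2 \<le> a i * (norm (cinner (v i) y))\<^sup>2"
    proof (cases "i \<le> k")
      case True
      then show ?thesis using i k by (intro mult_right_mono a) auto
    next
      case False
      then have "cinner (v i) y = 0" using i by (intro y(2)) auto
      then show ?thesis by simp
    qed
  qed
  moreover have "Re (cinner y (Y *v y)) \<le> b k * (\<Sum>i=1..CARD('n). (norm (cinner (w i) y))\<^sup>2)"
    unfolding quadratic_form_diagonalization[OF Y] sum_distrib_left
  proof (intro sum_mono)
    fix i assume i: "i \<in> {1..CARD('n)}"
    show "b i * (norm (cinner (w i) y))\<^sup>2 \<le> b k * (norm (cinner (w i) y))\<^sup>2"
    proof (cases "k \<le> i")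
      case True
      then show ?thesis using i k by (intro mult_right_mono b) auto
    next
      case False
      then have "cinner (w i) y = 0" using i by (intro y(2)) auto
      then show ?thesis by simp
    qed
  qed
  ultimately have "a k - b k \<le> Re (cinner y ((X - Y) *v y))"
    unfolding parseval[OF v] parseval[OF w]
    by (simp add: y(1) matrix_vector_mult_diff_rdistrib cinner_diff)
  also have "\<dots> \<le> norm (cinner y ((X - Y) *v y))" by (rule complex_Re_le_cmod)
  also have "\<dots> \<le> (\<Sum>i\<in>UNIV. \<Sum>j\<in>UNIV. norm ((X - Y) $ i $ j))"
    by (rule norm_quadratic_form_le[OF y(1)])
  finally show ?thesis .
qed

lemma ordered_eigenvalue_perturbation:
  fixes X Y :: "complex^'n^'n"
  assumes X: "diagonalization X a v" and Y: "diagonalization Y b w"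
    and a: "\<And>i j. 1 \<le> i \<Longrightarrow> i \<le> j \<Longrightarrow> j \<le> CARD('n) \<Longrightarrow> a j \<le> a i"
    and b: "\<And>i j. 1 \<le> i \<Longrightarrow> i \<le> j \<Longrightarrow> j \<le> CARD('n) \<Longrightarrow> b j \<le> b i"
    and k: "k \<in> {1..CARD('n)}"
  shows "\<bar>a k - b k\<bar> \<le> (\<Sum>i\<in>UNIV. \<Sum>j\<in>UNIV. norm ((X - Y) $ i $ j))"
proof -
  have "norm ((Y - X) $ i $ j) = norm ((X - Y) $ i $ j)" for i j
    by (simp add: norm_minus_commute)
  then show ?thesis
    using ordered_eigenvalue_perturbation_le[OF X Y a b k]
      ordered_eigenvalue_perturbation_le[OF Y X b a k]
    by (simp add: abs_le_iff)
qed

section \<open>Powers, and the matrix \<open>K A\<^sup>p K*\<close> as a weighted sum of rank-one operators\<close>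

definition weighted_frame :: "(nat \<Rightarrow> real) \<Rightarrow> (nat \<Rightarrow> complex^'n) \<Rightarrow> complex^'n^'n" where
  "weighted_frame c w = (\<Sum>i=1..CARD('n). c i *\<^sub>R ketbra (w i) (w i))"

lemma weighted_frame_mult:
  fixes w :: "nat \<Rightarrow> complex^'n"
  shows "weighted_frame c w *v x = (\<Sum>i=1..CARD('n). c i *\<^sub>R (cinner (w i) x *s w i))"
  unfolding weighted_frame_def by (rule sum_ketbra_mult) simp

lemma cinner_weighted_frame:
  fixes w :: "nat \<Rightarrow> complex^'n"
  shows "cinner e (weighted_frame c w *v x)
    = (\<Sum>i=1..CARD('n). of_real (c i) * (cinner (w i) x * cinner e (w i)))"
  by (simp only: weighted_frame_mult cinner_sum cinner_scaleR cinner_scale)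

lemma quadratic_form_weighted_frame:
  fixes w :: "nat \<Rightarrow> complex^'n"
  shows "cinner x (weighted_frame c w *v x)
    = of_real (\<Sum>i=1..CARD('n). c i * (norm (cinner (w i) x))\<^sup>2)"
proof -
  have "cinner x (weighted_frame c w *v x)
      = (\<Sum>i=1..CARD('n). of_real (c i) * (cinner (w i) x * cnj (cinner (w i) x)))"
    unfolding cinner_weighted_frame cinner_commute ..
  then show ?thesis by (simp only: of_real_sum complex_norm_square of_real_mult)
qed

lemma conj_transpose_eqI:
  fixes X :: "complex^'n^'n"
  assumes "\<And>x y. cinner y (X *v x) = cinner (X *v y) x"
  shows "conj_transpose X = X"
proof -
  have "conj_transpose X *v y = X *v y" for y
  proof -
    let ?z = "conj_transpose X *v y - X *v y"
    have "cinner ?z ?z = 0"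
      using assms[of y ?z] by (simp only: cinner_diff_left cinner_matrix[symmetric]) simp
    then show ?thesis by (simp add: cinner_self)
  qed
  then show ?thesis by (simp add: matrix_eq)
qed

lemma weighted_frame_hermitian: "conj_transpose (weighted_frame c w) = weighted_frame c w"
proof (rule conj_transpose_eqI)
  fix x y :: "complex^'a"
  have "cinner (weighted_frame c w *v y) x = cnj (cinner x (weighted_frame c w *v y))"
    by (simp only: cinner_commute)
  also have "\<dots> = cinner y (weighted_frame c w *v x)"
    unfolding cinner_weighted_frame cnj_sum complex_cnj_mult cinner_commute complex_cnj_complex_of_real
    by (simp only: mult.commute[of "cinner y _"])
  finally show "cinner y (weighted_frame c w *v x) = cinner (weighted_frame c w *v y) x" ..
qed

lemma weighted_frame_eigenvalue:
  fixes w :: "nat \<Rightarrow> complex^'n"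
  assumes "norm x = 1" "weighted_frame c w *v x = s *\<^sub>R x"
  shows "s = (\<Sum>i=1..CARD('n). c i * (norm (cinner (w i) x))\<^sup>2)"
proof -
  have "complex_of_real s = cinner x (weighted_frame c w *v x)"
    by (simp add: assms cinner_scaleR cinner_self)
  then show ?thesis unfolding quadratic_form_weighted_frame by (simp only: of_real_eq_iff)
qed

lemma mat_powr_diagonalization:
  assumes "diagonalization X s x"
  shows "diagonalization (mat_powr X r) (\<lambda>i. s i powr r) x"
proof -
  let ?Y = "\<Sum>i=1..CARD('a). (s i powr r) *\<^sub>R ketbra (x i) (x i)"
  have Y: "diagonalization ?Y (\<lambda>i. s i powr r) x" using assms by (simp add: diagonalization_def)
  then have "mat_powr X r = ?Y" unfolding mat_powr_def by (intro fun_calculus_eqI[OF assms])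
  with Y show ?thesis by simp
qed

text \<open>
  \<open>K |v\<rangle>\<langle>v| K* = |K v\<rangle>\<langle>K v|\<close>, summed over a diagonalization.
\<close>

lemma congruence_weighted_frame:
  fixes A K :: "complex^'n^'n"
  assumes "diagonalization A a v"
  shows "K ** A ** conj_transpose K = weighted_frame a (\<lambda>i. K *v v i)"
proof -
  have adj: "cinner y (conj_transpose K *v x) = cinner (K *v y) x" for x y
  proof -
    have "cnj (cinner y (conj_transpose K *v x)) = cnj (cinner (K *v y) x)"
      unfolding cinner_commute by (simp only: cinner_matrix)
    then show ?thesis by (simp only: complex_cnj_cancel_iff)
  qed
  have "(K ** A ** conj_transpose K) *v x = weighted_frame a (\<lambda>i. K *v v i) *v x" for x
  proof -
    have "(K ** A ** conj_transpose K) *v x = K *v (A *v (conj_transpose K *v x))"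
      by (simp add: matrix_vector_mul_assoc matrix_mul_assoc)
    also have "\<dots> = (\<Sum>i=1..CARD('n). K *v (a i *\<^sub>R (cinner (K *v v i) x *s v i)))"
      unfolding diagonalization_mult[OF assms] adj by (rule vec.linear_sum) simp
    also have "\<dots> = weighted_frame a (\<lambda>i. K *v v i) *v x"
      by (simp add: weighted_frame_mult scaleR_eq_scale vec.linear_scale)
    finally show ?thesis .
  qed
  then show ?thesis by (simp add: matrix_eq)
qed

section \<open>Overlaps of eigenvectors with a fixed vector\<close>

text \<open>
  Here \<open>s\<close> is the eigenvalue of \<open>M = \<Sum>\<^sub>i c\<^sub>i |w\<^sub>i\<rangle>\<langle>w\<^sub>i|\<close> at \<open>x\<close>. By the Cauchy-Schwarz inequality for
  the form of \<open>M\<close>, \<open>s\<^sup>2 |\<langle>e, x\<rangle>|\<^sup>2 = |\<langle>e, M x\<rangle>|\<^sup>2 \<le> \<langle>e, M e\<rangle> \<langle>x, M x\<rangle> = \<langle>e, M e\<rangle> s\<close>, and only the terms with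
  \<open>\<langle>e, w\<^sub>i\<rangle> \<noteq> 0\<close> contribute to \<open>\<langle>e, M e\<rangle>\<close>.
\<close>

lemma overlap_le_weight:
  fixes w :: "nat \<Rightarrow> complex^'n"
  assumes x: "norm x = 1" "weighted_frame c w *v x = s *\<^sub>R x"
    and c: "\<And>i. i \<in> {1..CARD('n)} \<Longrightarrow> 0 \<le> c i"
    and le: "\<And>i. i \<in> {1..CARD('n)} \<Longrightarrow> cinner e (w i) \<noteq> 0 \<Longrightarrow> c i \<le> d"
    and "0 \<le> d"
  shows "s * (norm (cinner e x))\<^sup>2 \<le> (\<Sum>i=1..CARD('n). (norm (cinner e (w i)))\<^sup>2) * d"
proof -
  let ?I = "{1..CARD('n)}"
  let ?f = "\<lambda>i. sqrt (c i) * norm (cinner (w i) x)" and ?g = "\<lambda>i. sqrt (c i) * norm (cinner e (w i))"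
  have s: "s = (\<Sum>i\<in>?I. c i * (norm (cinner (w i) x))\<^sup>2)"
    by (rule weighted_frame_eigenvalue[OF x])
  have s0: "0 \<le> s" unfolding s by (intro sum_nonneg mult_nonneg_nonneg c) auto
  have f: "(\<Sum>i\<in>?I. (?f i)\<^sup>2) = s"
    unfolding s by (intro sum.cong refl) (use c in \<open>simp add: power_mult_distrib\<close>)
  have "s * norm (cinner e x) = norm (cinner e (weighted_frame c w *v x))"
    using s0 by (simp add: x cinner_scaleR norm_mult)
  also have "\<dots> \<le> (\<Sum>i\<in>?I. ?f i * ?g i)"
    unfolding cinner_weighted_frame
  proof (intro sum_norm_le)
    fix i assume i: "i \<in> ?I"
    have "?f i * ?g i = (sqrt (c i) * sqrt (c i)) * (norm (cinner (w i) x) * norm (cinner e (w i)))"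
      by (simp only: mult_ac)
    then show "norm (of_real (c i) * (cinner (w i) x * cinner e (w i))) \<le> ?f i * ?g i"
      using c[OF i] by (simp only: norm_mult norm_of_real real_sqrt_mult_self abs_of_nonneg order_refl)
  qed
  finally have "(s * norm (cinner e x))\<^sup>2 \<le> (\<Sum>i\<in>?I. ?f i * ?g i)\<^sup>2"
    using s0 by (intro power_mono) auto
  also have "\<dots> \<le> s * (\<Sum>i\<in>?I. (?g i)\<^sup>2)"
    using Cauchy_Schwarz_ineq_sum[of ?f ?g ?I] unfolding f .
  finally have "s * (s * (norm (cinner e x))\<^sup>2) \<le> s * (\<Sum>i\<in>?I. (?g i)\<^sup>2)"
    by (simp add: power2_eq_square mult_ac)
  moreover have "(\<Sum>i\<in>?I. (?g i)\<^sup>2) \<le> (\<Sum>i\<in>?I. (norm (cinner e (w i)))\<^sup>2) * d"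
    unfolding sum_distrib_right
  proof (intro sum_mono)
    fix i assume i: "i \<in> ?I"
    show "(?g i)\<^sup>2 \<le> (norm (cinner e (w i)))\<^sup>2 * d"
      using le[OF i] c[OF i] by (cases "cinner e (w i) = 0") (auto simp: power_mult_distrib)
  qed
  ultimately have "s * (s * (norm (cinner e x))\<^sup>2) \<le> s * ((\<Sum>i\<in>?I. (norm (cinner e (w i)))\<^sup>2) * d)"
    using s0 by (meson mult_left_mono order_trans)
  then show ?thesis
    using s0 \<open>0 \<le> d\<close> by (cases "s = 0") (auto intro!: mult_nonneg_nonneg sum_nonneg)
qed

text \<open>
  The constant depends on the coefficients of \<open>e\<close> in terms of the \<open>w i\<close> but not on \<open>x\<close>. This is what
  makes all later estimates uniform in the exponent \<open>p\<close>, on which the eigenvector \<open>x\<close> depends.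
\<close>

lemma span_overlap_bound:
  fixes w :: "'i \<Rightarrow> complex^'n"
  assumes "finite I" "e \<in> vec.span (w ` I)"
  obtains C where "0 \<le> C"
    "\<And>x. (norm (cinner e x))\<^sup>2 \<le> C * (\<Sum>i\<in>I. (norm (cinner (w i) x))\<^sup>2)"
proof -
  let ?S = "\<lambda>x. \<Sum>i\<in>I. (norm (cinner (w i) x))\<^sup>2"
  have "\<exists>C\<ge>0. \<forall>x. (norm (cinner e x))\<^sup>2 \<le> C * ?S x"
    using assms(2)
  proof (induction e rule: vec.span_induct_alt)
    case base
    then show ?case by (intro exI[of _ 0]) simp
  next
    case (step c f e)
    then obtain C i where C: "0 \<le> C" "\<And>x. (norm (cinner e x))\<^sup>2 \<le> C * ?S x"
      and i: "i \<in> I" "f = w i" by auto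
    have "(norm (cinner (c *s f + e) x))\<^sup>2 \<le> (2 * (norm c)\<^sup>2 + 2 * C) * ?S x" for x
    proof -
      let ?p = "norm c * norm (cinner f x)" and ?q = "norm (cinner e x)"
      have f: "(norm (cinner f x))\<^sup>2 \<le> ?S x"
        unfolding i(2) by (rule member_le_sum) (use i assms(1) in auto)
      have "norm (cinner (c *s f + e) x) \<le> ?p + ?q"
        unfolding cinner_add_left cinner_scale_left
        by (rule order_trans[OF norm_triangle_ineq]) (simp add: norm_mult)
      then have "(norm (cinner (c *s f + e) x))\<^sup>2 \<le> (?p + ?q)\<^sup>2" by (intro power_mono) auto
      also have "\<dots> \<le> 2 * ?p\<^sup>2 + 2 * ?q\<^sup>2"
        using zero_le_power2[of "?p - ?q"] by (simp add: power2_eq_square algebra_simps)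
      also have "\<dots> = 2 * ((norm c)\<^sup>2 * (norm (cinner f x))\<^sup>2) + 2 * ?q\<^sup>2"
        by (simp add: power_mult_distrib)
      also have "\<dots> \<le> 2 * ((norm c)\<^sup>2 * ?S x) + 2 * (C * ?S x)"
        by (intro add_mono mult_left_mono f C) auto
      finally show ?thesis by (simp add: algebra_simps)
    qed
    then show ?case using C(1) by (intro exI[of _ "2 * (norm c)\<^sup>2 + 2 * C"]) auto
  qed
  then show ?thesis using that by blast
qed

text \<open>
  The bound in the opposite direction: if \<open>|\<langle>e, x\<rangle>|\<^sup>2\<close> is controlled by the overlaps of \<open>x\<close> with
  those \<open>w\<^sub>i\<close> whose weight is at least \<open>d\<close>, then \<open>d |\<langle>e, x\<rangle>|\<^sup>2\<close> is controlled by \<open>\<langle>x, M x\<rangle> = s\<close>.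
\<close>

lemma weight_overlap_le:
  fixes w :: "nat \<Rightarrow> complex^'n"
  assumes x: "norm x = 1" "weighted_frame c w *v x = s *\<^sub>R x"
    and c: "\<And>i. i \<in> {1..CARD('n)} \<Longrightarrow> 0 \<le> c i"
    and d: "\<And>i. i \<in> I \<Longrightarrow> d \<le> c i" "0 \<le> d"
    and I: "I \<subseteq> {1..CARD('n)}"
    and C: "0 \<le> C" "(norm (cinner e x))\<^sup>2 \<le> C * (\<Sum>i\<in>I. (norm (cinner (w i) x))\<^sup>2)"
  shows "d * (norm (cinner e x))\<^sup>2 \<le> C * s"
proof -
  have "d * (norm (cinner e x))\<^sup>2 \<le> d * (C * (\<Sum>i\<in>I. (norm (cinner (w i) x))\<^sup>2))"
    using d C by (intro mult_left_mono) auto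
  also have "\<dots> = C * (\<Sum>i\<in>I. d * (norm (cinner (w i) x))\<^sup>2)"
    by (simp add: sum_distrib_left mult_ac)
  also have "\<dots> \<le> C * (\<Sum>i\<in>I. c i * (norm (cinner (w i) x))\<^sup>2)"
    using d C by (intro mult_left_mono sum_mono mult_right_mono) auto
  also have "\<dots> \<le> C * (\<Sum>i=1..CARD('n). c i * (norm (cinner (w i) x))\<^sup>2)"
    using c C I by (intro mult_left_mono sum_mono2) auto
  finally show ?thesis by (simp only: weighted_frame_eigenvalue[OF x, symmetric])
qed

text \<open>
  With \<open>y = sqrt C / c\<close> and \<open>q = 2 / p\<close>, the hypothesis says \<open>t \<le> y\<^sup>q b\<close>, and Bernoulli's
  inequality \<open>y\<^sup>q \<le> 1 + q y\<close> gives \<open>(t - b) c \<le> q y b c = q sqrt C b\<close>. If \<open>c\<close> is small, \<open>t\<close> may be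
  far above \<open>b\<close>; the product is small in any case.
\<close>

lemma powr_overlap_gap:
  fixes t b c C p :: real
  assumes nonneg: "0 \<le> t" "0 \<le> b" "0 \<le> c" "0 \<le> C" and p: "2 \<le> p"
    and le: "t powr p * c\<^sup>2 \<le> C * b powr p"
  shows "(t - b) * c \<le> 2 * sqrt C * b / p"
proof (cases "c = 0")
  case True
  then show ?thesis using nonneg p by simp
next
  case False
  define y where "y = sqrt C / c"
  define q where "q = 2 / p"
  have y: "0 \<le> y" "y * c = sqrt C" using nonneg False by (simp_all add: y_def)
  have q: "0 \<le> q" "q \<le> 1" using p by (simp_all add: q_def)
  have "t powr p \<le> y\<^sup>2 * b powr p"
    using le False nonneg by (simp add: y_def power_divide pos_le_divide_eq)
  then have "(t powr p) powr (1 / p) \<le> (y\<^sup>2 * b powr p) powr (1 / p)"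
    using p by (intro powr_mono2) auto
  moreover have "(t powr p) powr (1 / p) = t" using nonneg p by (simp add: powr_powr)
  moreover have "(y\<^sup>2) powr (1 / p) = y powr q"
  proof (cases "y = 0")
    case False
    then have "y\<^sup>2 = y powr 2" using y by (simp add: powr_numeral)
    then show ?thesis by (simp add: powr_powr q_def)
  qed (simp add: q_def)
  then have "(y\<^sup>2 * b powr p) powr (1 / p) = y powr q * b"
    using nonneg p by (simp add: powr_mult powr_powr)
  ultimately have t: "t \<le> y powr q * b" by simp
  have "y powr q \<le> 1 + q * y"
  proof (cases "y = 0")
    case False
    \<comment> \<open>Bernoulli's inequality as the weighted mean inequality for \<open>y\<close> and \<open>1\<close>\<close>
    then have "y powr q * 1 powr (1 - q) \<le> q * y + (1 - q) * 1"
      using y q by (intro Youngs_inequality_0) auto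
    then show ?thesis using q by simp
  qed simp
  then have "y powr q * b \<le> (1 + q * y) * b" using nonneg by (intro mult_right_mono)
  with t have "(t - b) * c \<le> (q * y * b) * c"
    using nonneg by (intro mult_right_mono) (auto simp: algebra_simps)
  also have "\<dots> = q * (y * c) * b" by simp
  finally show ?thesis by (simp add: y(2) q_def)
qed

text \<open>
  The heart of the argument. The hypothesis \<open>upper\<close> gives \<open>t\<^sup>p |\<langle>e, x\<rangle>|\<^sup>2 \<le> C b\<^sup>p\<close>, the hypothesis
  \<open>lower\<close> gives \<open>b\<^sup>p |\<langle>e, x\<rangle>|\<^sup>2 \<le> C t\<^sup>p\<close>, both with \<open>C\<close> independent of \<open>p\<close>, \<open>t\<close> and \<open>x\<close>. So an
  eigenvector for \<open>t\<^sup>p\<close> can have a substantial overlap with \<open>e\<close> only if \<open>t\<close> is close to \<open>b\<close>.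
\<close>

lemma eigenvalue_gap_times_overlap:
  fixes w :: "nat \<Rightarrow> complex^'n"
  assumes a: "\<And>i. i \<in> {1..CARD('n)} \<Longrightarrow> 0 \<le> a i" and b: "0 \<le> b"
    and upper: "\<And>i. i \<in> {1..CARD('n)} \<Longrightarrow> cinner e (w i) \<noteq> 0 \<Longrightarrow> a i \<le> b"
    and lower: "b = 0 \<or> e \<in> vec.span (w ` {i \<in> {1..CARD('n)}. b \<le> a i})"
  obtains C where "0 \<le> C"
    "\<And>p t x. \<lbrakk>2 \<le> p; 0 \<le> t; norm x = 1; weighted_frame (\<lambda>i. a i powr p) w *v x = (t powr p) *\<^sub>R x\<rbrakk>
       \<Longrightarrow> \<bar>t - b\<bar> * norm (cinner e x) \<le> C / p"
proof -
  \<comment> \<open>for \<open>b = 0\<close> the lower bound is trivial, and the empty sum for \<open>e' = 0\<close> covers it\<close>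
  define I where "I = (if b = 0 then {} else {i \<in> {1..CARD('n)}. b \<le> a i})"
  define e' where "e' = (if b = 0 then 0 else e)"
  have I: "finite I" "I \<subseteq> {1..CARD('n)}" by (auto simp: I_def)
  have "e' \<in> vec.span (w ` I)" using lower by (auto simp: I_def e'_def)
  from span_overlap_bound[OF I(1) this] obtain C1 where C1: "0 \<le> C1"
    "\<And>x. (norm (cinner e' x))\<^sup>2 \<le> C1 * (\<Sum>i\<in>I. (norm (cinner (w i) x))\<^sup>2)" by blast
  define C2 where "C2 = (\<Sum>i=1..CARD('n). (norm (cinner e (w i)))\<^sup>2)"
  have C2: "0 \<le> C2" unfolding C2_def by (intro sum_nonneg) auto
  define C where "C = C1 + C2"
  show ?thesis
  proof (rule that)
    show "0 \<le> 2 * sqrt C * b" using b C1 C2 by (simp add: C_def)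
    fix p t :: real and x :: "complex^'n"
    assume p: "2 \<le> p" and t: "0 \<le> t" and x: "norm x = 1"
      and eig: "weighted_frame (\<lambda>i. a i powr p) w *v x = (t powr p) *\<^sub>R x"
    let ?c = "norm (cinner e x)"
    have "t powr p * ?c\<^sup>2 \<le> C2 * b powr p"
      unfolding C2_def using p a b upper
      by (intro overlap_le_weight[OF x eig] powr_mono2) auto
    also have "\<dots> \<le> C * b powr p" using C1 by (intro mult_right_mono) (auto simp: C_def)
    finally have 1: "(t - b) * ?c \<le> 2 * sqrt C * b / p"
      using p t b C1 C2 by (intro powr_overlap_gap) (auto simp: C_def)
    have "b powr p * (norm (cinner e' x))\<^sup>2 \<le> C1 * t powr p"
      by (rule weight_overlap_le[OF x eig _ _ _ I(2) C1])
        (use p b in \<open>auto simp: I_def intro!: powr_mono2 split: if_splits\<close>)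
    then have "b powr p * ?c\<^sup>2 \<le> C1 * t powr p"
      using C1 by (auto simp: e'_def split: if_splits)
    also have "\<dots> \<le> C * t powr p" using C2 by (intro mult_right_mono) (auto simp: C_def)
    finally have 2: "(b - t) * ?c \<le> 2 * sqrt C * t / p"
      using p t b C1 C2 by (intro powr_overlap_gap) (auto simp: C_def)
    show "\<bar>t - b\<bar> * ?c \<le> 2 * sqrt C * b / p"
    proof (cases "b \<le> t")
      case True
      with 1 show ?thesis by simp
    next
      case False
      then have "2 * sqrt C * t / p \<le> 2 * sqrt C * b / p"
        using p C1 C2 by (intro divide_right_mono mult_left_mono) (auto simp: C_def)
      with 2 False show ?thesis by simp
    qed
  qed
qed

section \<open>Comparing two diagonalized matrices through their overlaps\<close>

text \<open>
  Expand \<open>y\<close> in the eigenvectors \<open>x j\<close> of \<open>X\<close>: in the mixed bases, the matrix elements of \<open>X - Y\<close>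
  are \<open>(t j - b k) \<langle>u k, x j\<rangle>\<close>.
\<close>

lemma cinner_diagonalization_diff:
  fixes X Y :: "complex^'n^'n"
  assumes X: "diagonalization X t x" and Y: "diagonalization Y b u" and k: "k \<in> {1..CARD('n)}"
  shows "norm (cinner (u k) ((X - Y) *v y))
    \<le> norm y * (\<Sum>j=1..CARD('n). \<bar>t j - b k\<bar> * norm (cinner (u k) (x j)))"
proof -
  have x: "orthonormal_basis x" using X by (simp add: diagonalization_def)
  have "cinner (u k) ((X - Y) *v y) = cinner (u k) (X *v y) - of_real (b k) * cinner (u k) y"
    by (simp add: matrix_vector_mult_diff_rdistrib cinner_diff cinner_diagonalization[OF Y k])
  also have "cinner (u k) y = (\<Sum>j=1..CARD('n). cinner (x j) y * cinner (u k) (x j))"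
    by (subst orthonormal_basis_expand[OF x, of y, symmetric]) (simp only: cinner_sum cinner_scale)
  also have "cinner (u k) (X *v y) = (\<Sum>j=1..CARD('n). of_real (t j) * (cinner (x j) y * cinner (u k) (x j)))"
    by (simp only: diagonalization_mult[OF X] cinner_sum cinner_scale cinner_scaleR)
  finally have "cinner (u k) ((X - Y) *v y)
      = (\<Sum>j=1..CARD('n). of_real (t j - b k) * (cinner (x j) y * cinner (u k) (x j)))"
    by (simp add: sum_distrib_left sum_subtractf algebra_simps)
  also have "norm \<dots> \<le> (\<Sum>j=1..CARD('n). norm y * (\<bar>t j - b k\<bar> * norm (cinner (u k) (x j))))"
  proof (intro sum_norm_le)
    fix j assume j: "j \<in> {1..CARD('n)}"
    have "(norm (cinner (x j) y))\<^sup>2 \<le> (\<Sum>i=1..CARD('n). (norm (cinner (x i) y))\<^sup>2)"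
      by (rule member_le_sum[OF j]) auto
    then have "norm (cinner (x j) y) \<le> norm y" unfolding parseval[OF x] by simp
    then have "norm (cinner (x j) y) * (\<bar>t j - b k\<bar> * norm (cinner (u k) (x j)))
        \<le> norm y * (\<bar>t j - b k\<bar> * norm (cinner (u k) (x j)))"
      by (rule mult_right_mono) simp
    then show "norm (of_real (t j - b k) * (cinner (x j) y * cinner (u k) (x j)))
        \<le> norm y * (\<bar>t j - b k\<bar> * norm (cinner (u k) (x j)))"
      by (simp only: norm_mult norm_of_real mult_ac)
  qed
  finally show ?thesis by (simp only: sum_distrib_left)
qed

lemma norm_entry_diagonalization_diff:
  fixes X Y :: "complex^'n^'n"
  assumes X: "diagonalization X t x" and Y: "diagonalization Y b u"
  shows "norm ((X - Y) $ i $ j)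
    \<le> (\<Sum>k=1..CARD('n). \<Sum>h=1..CARD('n). \<bar>t h - b k\<bar> * norm (cinner (u k) (x h)))"
proof -
  have u: "orthonormal_basis u" using Y by (simp add: diagonalization_def)
  define z where "z = (X - Y) *v axis j 1"
  have "(X - Y) $ i $ j = z $ i" 
    by (simp add: z_def matrix_vector_mult_def axis_def if_distrib[of "\<lambda>c. _ * c"] cong: if_cong)
  also have "norm (z $ i) \<le> norm z" by (rule Finite_Cartesian_Product.norm_nth_le)
  also have "norm z = L2_set (\<lambda>k. norm (cinner (u k) z)) {1..CARD('n)}"
    unfolding L2_set_def parseval[OF u] by simp
  also have "\<dots> \<le> (\<Sum>k=1..CARD('n). norm (cinner (u k) z))"
    by (rule L2_set_le_sum) simp
  also have "\<dots> \<le> (\<Sum>k=1..CARD('n). \<Sum>h=1..CARD('n). \<bar>t h - b k\<bar> * norm (cinner (u k) (x h)))"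
  proof (intro sum_mono)
    fix k assume k: "k \<in> {1..CARD('n)}"
    have "norm (axis j (1 :: complex)) = 1" by (simp add: norm_eq_sqrt_inner inner_axis_axis)
    then show "norm (cinner (u k) z) \<le> (\<Sum>h=1..CARD('n). \<bar>t h - b k\<bar> * norm (cinner (u k) (x h)))"
      using cinner_diagonalization_diff[OF X Y k, of "axis j 1"] by (simp add: z_def)
  qed
  finally show ?thesis .
qed

section \<open>The limit\<close>

theorem theorem2p1:
  fixes A K :: "complex^'n^'n"
    and a :: "nat \<Rightarrow> real" and v u :: "nat \<Rightarrow> complex^'n"
    and l :: "nat \<Rightarrow> nat" and m :: nat
  assumes "psd A"
    and "diagonalization A a v"
    and "\<And>i j. 1 \<le> i \<Longrightarrow> i \<le> j \<Longrightarrow> j \<le> CARD('n) \<Longrightarrow> a j \<le> a i"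
    and "\<And>i. i \<in> {1..CARD('n)} \<Longrightarrow> 0 \<le> a i"
    and "K \<noteq> 0"
    and "strict_mono_on {1..m} l"
    and "l ` {1..m} =
           {i \<in> {1..CARD('n)}. K *v v i \<notin> vec.span ((\<lambda>j. K *v v j) ` {1..<i})}"
    and "\<And>k. k \<in> {1..m} \<Longrightarrow> u k = gram_schmidt (\<lambda>j. K *v v (l j)) k"
  shows "((\<lambda>p::real. mat_powr (K ** mat_powr A p ** conj_transpose K) (1 / p))
            \<longlongrightarrow> (\<Sum>k=1..m. a (l k) *\<^sub>R ketbra (u k) (u k))) at_top
       \<and> (\<forall>k\<in>{1..CARD('n)}.
            ((\<lambda>p::real. eigval (mat_powr (K ** mat_powr A p ** conj_transpose K) (1 / p)) k)
              \<longlongrightarrow> (if k \<le> m then a (l k) else 0)) at_top)"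
proof -
  let ?n = "CARD('n)"
  define w where "w = (\<lambda>i. K *v v i)"
  define w' where "w' = (\<lambda>k. w (l k))"
  define g where "g = gram_schmidt w'"
  define N where "N = (\<lambda>p::real. mat_powr (K ** mat_powr A p ** conj_transpose K) (1 / p))"
  note dec = assms(3) and nonneg = assms(4)
  have l_less: "l i < l j" if "i \<in> {1..m}" "j \<in> {1..m}" "i < j" for i j
    using assms(6) that by (auto simp: strict_mono_on_def)
  have l_le: "l i \<le> l j" if "i \<in> {1..m}" "j \<in> {1..m}" "i \<le> j" for i j
    using l_less[OF that(1,2)] that(3) by (cases "i = j") auto
  have l_range: "l k \<in> {1..?n}" and l_indep: "w (l k) \<notin> vec.span (w ` {1..<l k})"
    if "k \<in> {1..m}" for k
    using that assms(7) unfolding w_def by blast+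
  have pivots: "i \<in> l ` {1..m}" if "i \<in> {1..?n}" "w i \<notin> vec.span (w ` {1..<i})" for i
    using that assms(7) unfolding w_def by blast
  have "m \<le> ?n"
  proof -
    have "inj_on l {1..m}" using l_less by (intro inj_onI) (metis less_irrefl nat_neq_iff)
    moreover have "l ` {1..m} \<subseteq> {1..?n}" using l_range by auto
    ultimately show ?thesis using card_inj_on_le[of l "{1..m}" "{1..?n}"] by simp
  qed
  \<comment> \<open>all earlier pivot vectors are among the vectors preceding \<open>w (l k)\<close>\<close>
  have w'_indep: "w' k \<notin> vec.span (w' ` {1..<k})" if k: "k \<in> {1..m}" for k
  proof -
    have "w' ` {1..<k} \<subseteq> w ` {1..<l k}"
    proof
      fix z assume "z \<in> w' ` {1..<k}"
      then obtain j where j: "j \<in> {1..<k}" "z = w (l j)" by (auto simp: w'_def)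
      then have "l j < l k" "l j \<in> {1..?n}" using k l_less[of j k] l_range[of j] by simp_all
      with j show "z \<in> w ` {1..<l k}" by auto
    qed
    then show ?thesis using l_indep[OF k] vec.span_mono[of "w' ` {1..<k}"] by (auto simp: w'_def)
  qed
  have g_on: "orthonormal_upto m g" and g_span: "k \<le> m \<Longrightarrow> vec.span (g ` {1..k}) = vec.span (w' ` {1..k})" for k
    using gram_schmidt_orthonormal_span[of m w', OF w'_indep] by (auto simp: g_def)
  have ug: "u k = g k" if "k \<in> {1..m}" for k
    using assms(8)[OF that] by (simp add: g_def w'_def w_def)
  \<comment> \<open>completing the Gram-Schmidt vectors to a basis turns the candidate limit into a diagonalization
      with decreasing eigenvalues \<open>b\<close>, padded by zeros\<close>
  obtain e where e: "orthonormal_basis e" and eg: "\<And>k. k \<in> {1..m} \<Longrightarrow> e k = g k"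
    using orthonormal_upto_extend[OF g_on \<open>m \<le> ?n\<close>] by blast
  define b where "b k = (if k \<le> m then a (l k) else 0)" for k
  define D where "D = (\<Sum>k=1..m. a (l k) *\<^sub>R ketbra (u k) (u k))"
  have D: "diagonalization D b e"
  proof -
    have "D = (\<Sum>k=1..m. b k *\<^sub>R ketbra (e k) (e k))"
      unfolding D_def by (intro sum.cong) (auto simp: b_def ug eg)
    also have "\<dots> = (\<Sum>k=1..?n. b k *\<^sub>R ketbra (e k) (e k))"
      using \<open>m \<le> ?n\<close> by (intro sum.mono_neutral_left) (auto simp: b_def)
    finally show ?thesis using e by (simp add: diagonalization_def)
  qed
  have b_nonneg: "0 \<le> b k" if "k \<in> {1..?n}" for k
    using that l_range[of k] nonneg[of "l k"] by (auto simp: b_def)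
  have b_dec: "b j \<le> b i" if "1 \<le> i" "i \<le> j" "j \<le> ?n" for i j
  proof (cases "j \<le> m")
    case True
    then have "l i \<le> l j" "l i \<in> {1..?n}" "l j \<in> {1..?n}"
      using that l_le[of i j] l_range[of i] l_range[of j] by simp_all
    then show ?thesis using True that dec[of "l i" "l j"] by (auto simp: b_def)
  next
    case False
    then show ?thesis using b_nonneg[of i] that by (simp add: b_def)
  qed
  \<comment> \<open>the triangular structure of the Gram-Schmidt process: \<open>K v\<^sub>i\<close> lies in the span of the
      \<open>e k\<close> with \<open>l k \<le> i\<close>\<close>
  have w_orth: "cinner (e k) (w i) = 0"
    if k: "k \<in> {1..?n}" and i: "i \<in> {1..?n}" and lt: "k \<le> m \<Longrightarrow> i < l k" for k i
  proof -
    \<comment> \<open>\<open>w i\<close> is spanned by \<open>e 1, \<dots>, e h\<close>, and \<open>h < k\<close>\<close>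
    define h where "h = (if k \<le> m then k - 1 else m)"
    have h: "h \<le> m" "h < k" using k by (auto simp: h_def)
    have "w i \<in> vec.span (w ` {j \<in> l ` {1..m}. j \<le> i})"
      by (rule span_pivots[OF pivots i])
    also have "\<dots> \<subseteq> vec.span (w' ` {1..h})"
    proof (intro vec.span_mono subsetI)
      fix z assume "z \<in> w ` {j \<in> l ` {1..m}. j \<le> i}"
      then obtain j where j: "j \<in> {1..m}" "l j \<le> i" "z = w' j" by (auto simp: w'_def)
      have "j < k" if "k \<le> m"
      proof (rule ccontr)
        assume "\<not> j < k"
        then have "l k \<le> l j" using j k that by (intro l_le) auto
        with lt[OF that] j show False by simp
      qed
      then show "z \<in> w' ` {1..h}" using j by (auto simp: h_def)
    qed
    also have "\<dots> = vec.span (g ` {1..h})" using g_span h by simp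
    also have "g ` {1..h} = e ` {1..h}" using eg h by (intro image_cong) auto
    finally have "cinner (w i) (e k) = 0"
    proof (rule cinner_span_eq_0)
      fix s assume "s \<in> e ` {1..h}"
      then show "cinner s (e k) = 0"
        using e h k \<open>m \<le> ?n\<close> by (auto simp: orthonormal_basis_def)
    qed
    then show ?thesis by (simp add: cinner_eq_0_commute)
  qed
  have "\<exists>C\<ge>0. \<forall>p t x. 2 \<le> p \<longrightarrow> 0 \<le> t \<longrightarrow> norm x = 1 \<longrightarrow>
      weighted_frame (\<lambda>i. a i powr p) w *v x = (t powr p) *\<^sub>R x \<longrightarrow>
      \<bar>t - b k\<bar> * norm (cinner (e k) x) \<le> C / p" if k: "k \<in> {1..?n}" for k
  proof -
    have upper: "a i \<le> b k" if i: "i \<in> {1..?n}" and "cinner (e k) (w i) \<noteq> 0" for i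
    proof -
      have "k \<le> m" "l k \<le> i" using w_orth[OF k i] that not_less by blast+
      then show ?thesis using dec[of "l k" i] l_range[of k] i k by (auto simp: b_def)
    qed
    have lower: "b k = 0 \<or> e k \<in> vec.span (w ` {i \<in> {1..?n}. b k \<le> a i})"
    proof (cases "k \<le> m")
      case True
      then have k': "k \<in> {1..m}" using k by simp
      then have "e k \<in> vec.span (g ` {1..k})" using eg by (auto intro: vec.span_base)
      also have "\<dots> = vec.span (w' ` {1..k})" using g_span True by simp
      also have "\<dots> \<subseteq> vec.span (w ` {i \<in> {1..?n}. b k \<le> a i})"
      proof (intro vec.span_mono subsetI)
        fix z assume "z \<in> w' ` {1..k}"
        then obtain j where j: "j \<in> {1..m}" "j \<le> k" "z = w (l j)" using True by (auto simp: w'_def)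
        then have "l j \<le> l k" "l j \<in> {1..?n}" "l k \<in> {1..?n}"
          using k' l_le[of j k] l_range[of j] l_range[of k] by simp_all
        then have "b k \<le> a (l j)" using dec[of "l j" "l k"] True by (auto simp: b_def)
        with j \<open>l j \<in> {1..?n}\<close> show "z \<in> w ` {i \<in> {1..?n}. b k \<le> a i}" by blast
      qed
      finally show ?thesis ..
    qed (simp add: b_def)
    show ?thesis
      by (rule eigenvalue_gap_times_overlap[OF nonneg b_nonneg[OF k] upper lower]) blast+
  qed
  then obtain C where C: "\<And>k p t x. \<lbrakk>k \<in> {1..?n}; 2 \<le> p; 0 \<le> t; norm x = 1;
      weighted_frame (\<lambda>i. a i powr p) w *v x = (t powr p) *\<^sub>R x\<rbrakk>
      \<Longrightarrow> \<bar>t - b k\<bar> * norm (cinner (e k) x) \<le> C k / p"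
    by metis
  define B where "B = real ?n * (\<Sum>k=1..?n. C k)"
  have N: "\<exists>t x. diagonalization (N p) t x \<and> (\<forall>i j. 1 \<le> i \<longrightarrow> i \<le> j \<longrightarrow> j \<le> ?n \<longrightarrow> t j \<le> t i) \<and>
      (\<forall>i j. norm ((N p - D) $ i $ j) \<le> B / p)" if p: "2 \<le> p" for p
  proof -
    let ?M = "weighted_frame (\<lambda>i. a i powr p) w"
    obtain s x where s: "diagonalization ?M s x"
      and s_dec: "\<And>i j. 1 \<le> i \<Longrightarrow> i \<le> j \<Longrightarrow> j \<le> ?n \<Longrightarrow> s j \<le> s i"
      using hermitian_diagonalization[OF weighted_frame_hermitian] by blast
    have x: "norm (x h) = 1" if "h \<in> {1..?n}" for h
      using s that by (intro orthonormal_upto_norm) (auto simp: diagonalization_def orthonormal_basis_iff)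
    have s_nonneg: "0 \<le> s h" if h: "h \<in> {1..?n}" for h
      unfolding weighted_frame_eigenvalue[OF x[OF h] diagonalization_eigenvector[OF s h]]
      by (intro sum_nonneg mult_nonneg_nonneg) auto
    define t where "t = (\<lambda>h. s h powr (1 / p))"
    have "N p = mat_powr ?M (1 / p)"
      unfolding N_def w_def
      by (simp only: congruence_weighted_frame[OF mat_powr_diagonalization[OF assms(2)]])
    then have Nt: "diagonalization (N p) t x"
      unfolding t_def using mat_powr_diagonalization[OF s] by simp
    have t_dec: "t j \<le> t i" if "1 \<le> i" "i \<le> j" "j \<le> ?n" for i j
      unfolding t_def using s_dec[OF that] s_nonneg[of j] p that by (intro powr_mono2) auto
    have gap: "\<bar>t h - b k\<bar> * norm (cinner (e k) (x h)) \<le> C k / p"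
      if k: "k \<in> {1..?n}" and h: "h \<in> {1..?n}" for k h
    proof (rule C[OF k p _ x[OF h]])
      show "0 \<le> t h" by (simp add: t_def)
      have "t h powr p = s h" using s_nonneg[OF h] p by (simp add: t_def powr_powr)
      then show "?M *v x h = (t h powr p) *\<^sub>R x h"
        using diagonalization_eigenvector[OF s h] by simp
    qed
    have "norm ((N p - D) $ i $ j) \<le> B / p" for i j
    proof -
      have "norm ((N p - D) $ i $ j)
          \<le> (\<Sum>k=1..?n. \<Sum>h=1..?n. \<bar>t h - b k\<bar> * norm (cinner (e k) (x h)))"
        by (rule norm_entry_diagonalization_diff[OF Nt D])
      also have "\<dots> \<le> (\<Sum>k=1..?n. \<Sum>h=1..?n. C k / p)" by (intro sum_mono gap)
      also have "\<dots> = B / p" by (simp add: B_def sum_distrib_left sum_divide_distrib)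
      finally show ?thesis .
    qed
    with Nt t_dec show ?thesis by blast
  qed
  have entry: "((\<lambda>p. (N p - D) $ i $ j) \<longlongrightarrow> 0) at_top" for i j
  proof (rule Lim_null_comparison)
    show "\<forall>\<^sub>F p in at_top. norm ((N p - D) $ i $ j) \<le> B / p"
      using eventually_ge_at_top[of 2] by eventually_elim (use N in blast)
    show "((\<lambda>p. B / p) \<longlongrightarrow> 0) at_top"
      by (intro tendsto_divide_0[OF tendsto_const] filterlim_at_top_imp_at_infinity filterlim_ident)
  qed
  have "((\<lambda>p. N p - D) \<longlongrightarrow> 0) at_top"
    by (intro vec_tendstoI) (use entry in simp)
  then have "(N \<longlongrightarrow> D) at_top" by (rule LIM_zero_cancel)
  moreover have "((\<lambda>p. eigval (N p) k) \<longlongrightarrow> b k) at_top" if k: "k \<in> {1..?n}" for k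
  proof (rule LIM_zero_cancel, rule Lim_null_comparison)
    show "\<forall>\<^sub>F p in at_top. norm (eigval (N p) k - b k) \<le> (\<Sum>i\<in>UNIV. \<Sum>j\<in>UNIV. norm ((N p - D) $ i $ j))"
      using eventually_ge_at_top[of 2]
    proof eventually_elim
      case (elim p)
      then obtain t x where t: "diagonalization (N p) t x"
        "\<And>i j. 1 \<le> i \<Longrightarrow> i \<le> j \<Longrightarrow> j \<le> ?n \<Longrightarrow> t j \<le> t i"
        using N by blast
      have "eigval (N p) k = t k" by (rule eigval_diagonalization[OF t k])
      moreover have "\<bar>t k - b k\<bar> \<le> (\<Sum>i\<in>UNIV. \<Sum>j\<in>UNIV. norm ((N p - D) $ i $ j))"
        by (rule ordered_eigenvalue_perturbation[OF t(1) D t(2) b_dec k])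
      ultimately show ?case by (simp only: real_norm_def)
    qed
    show "((\<lambda>p. \<Sum>i\<in>UNIV. \<Sum>j\<in>UNIV. norm ((N p - D) $ i $ j)) \<longlongrightarrow> 0) at_top"
      by (intro tendsto_null_sum tendsto_norm_zero entry)
  qed
  ultimately show ?thesis by (simp add: N_def D_def b_def)
qed

end
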